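(* Let $H$ be an $r$-uniform hypergraph, let $\gamma>1$, and let $\alpha>r-1/m_r(H)$. Suppose that $n$ is a positive integer and $M$ is such that for every $s\in\{1,\dots,n\}$, \[ \mathrm{ex}(s,H)\le M\cdot\left(\frac{s}{n}\right)^{\alpha}. \] Then there exists a constant $t_0$ depending only on $\alpha$, $\gamma$, and $H$ such that the following holds. If $G$ is an $n$-vertex $r$-uniform hypergraph with $\gamma^t M<e(G)\le\gamma^{t+1}M$ for some integer $t\ge t_0$, then there is a collection $\mathcal{H}_G$ of copies of $H$ in $G$ (viewed as an $e_H$-uniform hypergraph on vertex set $E(G)$) such that, with $b_t=\frac{M}{(t+1)^3}$, \[ \Delta_\ell(\mathcal{H}_G)\le 2^{2e_H+3}\cdot\left(\frac{b_t}{e(G)}\right)^{\ell-1}\cdot\frac{e(\mathcal{H}_G)}{e(G)} \] for every $\ell\in\{1,\dots,e_H\}$. Moreover, there exists a constant $C$ depending only on $\alpha$ and $H$ such that $|\mathcal{F}_n(H)|\le 2^{C\cdot M}$.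
   Context: For an $r$-uniform hypergraph $H$, $\mathrm{ex}(s,H)$ is the maximum number of edges in an $s$-vertex $H$-free $r$-uniform hypergraph, and $\mathcal{F}_n(H)$ is the set of all labeled $H$-free $r$-uniform hypergraphs on vertex set $[n]$. The $r$-density is $m_r(H)=\max\{\frac{e_F-1}{v_F-r} : F\subseteq H,\ v_F>r\}$; $v_F,e_F$ denote numbers of vertices and edges, and $e_H$ is the number of edges of $H$. For a uniform hypergraph $\mathcal{H}$, $\Delta_\ell(\mathcal{H})$ is the maximum number of edges of $\mathcal{H}$ containing a given set of $\ell$ vertices, and $e(\mathcal{H})$ its number of edges. *)

theory Defs
  imports Complex_Main
begin

datatype 'a hypergraph = Hypergraph (verts: "'a set") (edges: "'a set set")

definition uniform_hypergraph :: "nat \<Rightarrow> 'a hypergraph \<Rightarrow> bool" where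
  "uniform_hypergraph r G \<longleftrightarrow>
     finite (verts G) \<and> (\<forall>e\<in>edges G. e \<subseteq> verts G \<and> card e = r)"

definition subhypergraph :: "'a hypergraph \<Rightarrow> 'a hypergraph \<Rightarrow> bool" where
  "subhypergraph F H \<longleftrightarrow> verts F \<subseteq> verts H \<and> edges F \<subseteq> edges H"

text \<open>A copy of \<open>H\<close> in \<open>G\<close> is represented by its set of edges, so that it can serve as
  an edge of a hypergraph whose vertices are the edges of \<open>G\<close>. Isolated vertices of \<open>H\<close>
  still have to be embedded into \<open>G\<close>, but two copies with the same edges are identified.\<close>

definition copies :: "'a hypergraph \<Rightarrow> 'b hypergraph \<Rightarrow> 'b set set set" where
  "copies H G = {(\<lambda>e. \<phi> ` e) ` edges H | \<phi>.
     inj_on \<phi> (verts H) \<and> \<phi> ` verts H \<subseteq> verts G \<and> (\<lambda>e. \<phi> ` e) ` edges H \<subseteq> edges G}"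

definition hfree :: "'a hypergraph \<Rightarrow> 'b hypergraph \<Rightarrow> bool" where
  "hfree H G \<longleftrightarrow> copies H G = {}"

definition ex_num :: "nat \<Rightarrow> nat \<Rightarrow> 'a hypergraph \<Rightarrow> nat" where
  "ex_num r s H = Max {card (edges G) | G :: nat hypergraph.
     uniform_hypergraph r G \<and> card (verts G) = s \<and> hfree H G}"

definition free_hypergraphs :: "nat \<Rightarrow> nat \<Rightarrow> 'a hypergraph \<Rightarrow> nat hypergraph set" where
  "free_hypergraphs r n H = {G. uniform_hypergraph r G \<and> verts G = {1..n} \<and> hfree H G}"

text \<open>The maximum is over a nonempty set as soon as \<open>H\<close> has more than \<open>r\<close> vertices,
  and is positive as soon as \<open>H\<close> has at least two edges.\<close>

definition r_density :: "nat \<Rightarrow> 'a hypergraph \<Rightarrow> real" where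
  "r_density r H = Max {(real (card (edges F)) - 1) / (real (card (verts F)) - real r) | F.
     uniform_hypergraph r F \<and> subhypergraph F H \<and> card (verts F) > r}"

definition max_degree :: "nat \<Rightarrow> 'a hypergraph \<Rightarrow> nat" where
  "max_degree l G = Max {card {e \<in> edges G. T \<subseteq> e} | T. T \<subseteq> verts G \<and> card T = l}"

end

theory Submission
  imports Defs "HOL-Real_Asymp.Real_Asymp"
begin

text \<open>
  Balanced copies: write \<open>k = e_H\<close> and \<open>D = e(G) / b_t\<close>, and take a maximal family of copies in which every
  set \<open>T\<close> of edges has degree at most \<open>D ^ (k - |T|)\<close>. If the family is too small, few sets are
  saturated. In a random set of about \<open>D powr (- m) n\<close> vertices, \<open>m\<close> being the \<open>r\<close>-density, the
  density bound on the number of vertices spanned by a saturated set shows that deleting one edge per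
  saturated set still leaves more than \<open>ex(s, H)\<close> edges. This produces a copy without saturated subsets,
  contradicting maximality.

  Containers: the fingerprint of an independent set \<open>I\<close> of a \<open>(j + 1)\<close>-uniform weight \<open>w\<close> is a maximal
  \<open>S \<subseteq> I\<close> whose links support a \<open>j\<close>-uniform weight of bounded degrees and of total mass at least
  \<open>\<beta> |S|\<close>. Either this link weight is heavy, and one recurses on it, or a positive proportion of the
  vertices extend \<open>S\<close>; by maximality \<open>I\<close> avoids these outside \<open>S\<close>. In both cases the containers
  depend on \<open>S\<close> only.

  Counting: with \<open>\<gamma> = 1 / (1 - \<delta>)\<close>, passing from a graph to its containers lowers \<open>t\<close> by one
  at the cost of a factor \<open>exp (O(M / t\<^sup>2))\<close>, and these factors have a convergent product.
\<close>

section \<open>Containers for weighted hypergraphs\<close>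

text \<open>At sampling rate \<open>p = D powr (- m)\<close>, the definition of the r-density gives
  p^(v_F - r) \<le> D^(1 - e_F) for every F in H with v_F > r and e_F \<ge> 1, so saturated sets
  survive in the sample no more often than the cap D^(k - |T|) allows; this is why the cap has this
  form. About p^r e(G) edges remain, to be compared with ex(s, H), which is at most about M
  p^\<alpha>. The quotient is (e(G) / M) D^(- m (r - \<alpha>)), and \<alpha> > r - 1 / m says
  exactly that the exponent of D exceeds -1. Since D is e(G) / M up to the factor (t + 1)^3, a
  positive power of \<gamma>^t is left over, and it absorbs every polynomial in t. That freedom pays
  for the containers: a fingerprint has O(b_t) of the e(G) elements, so encoding it costs b_t
  ln(e(G) / b_t), of order b_t (t + 1). The cube in b_t turns this into M / (t + 1)^2, which is
  summable. The argument runs with \<alpha> < r and at least two edges in H; larger \<alpha> is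
  lowered, and H with one edge or none is treated apart.\<close>

definition wt_deg :: "'v set \<Rightarrow> ('v set \<Rightarrow> real) \<Rightarrow> 'v set \<Rightarrow> real" where
  "wt_deg V w T = (\<Sum>e | e \<subseteq> V \<and> T \<subseteq> e. w e)"

text \<open>In the application \<open>V = E(G)\<close>, \<open>q = b_t / e(G)\<close>, and \<open>w\<close> is the indicator of the family of
  copies, rescaled to have total weight \<open>e(G)\<close>.\<close>

definition balanced :: "nat \<Rightarrow> 'v set \<Rightarrow> real \<Rightarrow> real \<Rightarrow> ('v set \<Rightarrow> real) \<Rightarrow> bool" where
  "balanced j V K q w \<longleftrightarrow> (\<forall>e. 0 \<le> w e) \<and> (\<forall>e. w e \<noteq> 0 \<longrightarrow> e \<subseteq> V \<and> card e = j) \<and>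
     (\<forall>T. T \<noteq> {} \<longrightarrow> wt_deg V w T \<le> K * q ^ (card T - 1))"

definition small_subsets :: "'v set \<Rightarrow> real \<Rightarrow> 'v set set" where
  "small_subsets V x = {S. S \<subseteq> V \<and> real (card S) \<le> x}"

definition covers :: "'v set \<Rightarrow> ('v set \<Rightarrow> real) \<Rightarrow> 'v set set \<Rightarrow> bool" where
  "covers V w \<C> \<longleftrightarrow> (\<forall>I\<subseteq>V. (\<forall>e. w e \<noteq> 0 \<longrightarrow> \<not> e \<subseteq> I) \<longrightarrow> (\<exists>C\<in>\<C>. I \<subseteq> C))"

lemma finite_small_subsets [simp]: "finite V \<Longrightarrow> finite (small_subsets V x)"
  unfolding small_subsets_def by (rule finite_subset[of _ "Pow V"]) auto

lemma small_subsets_mono: "x \<le> y \<Longrightarrow> small_subsets V x \<subseteq> small_subsets V y"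
  unfolding small_subsets_def by auto

lemma finite_subsets_Collect [simp]: "finite V \<Longrightarrow> finite {e. e \<subseteq> V \<and> P e}"
  by (rule finite_subset[of _ "Pow V"]) auto

section \<open>Counting small sets, and double counting of degrees\<close>

lemma sum_Pow_power_card:
  fixes q :: "'b::comm_semiring_1"
  assumes "finite V"
  shows "(\<Sum>S\<in>Pow V. q ^ card S) = (1 + q) ^ card V"
  using assms
proof (induction V rule: finite_induct)
  case empty
  then show ?case by simp
next
  case (insert x V)
  have inj: "inj_on (insert x) (Pow V)"
    using insert.hyps by (auto simp: inj_on_def)
  have disj: "Pow V \<inter> insert x ` Pow V = {}"
    using insert.hyps by auto
  have "(\<Sum>S\<in>insert x ` Pow V. q ^ card S) = (\<Sum>S\<in>Pow V. q ^ card (insert x S))"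
    by (simp add: sum.reindex[OF inj])
  also have "\<dots> = (\<Sum>S\<in>Pow V. q * q ^ card S)"
    using insert.hyps by (intro sum.cong refl) (auto simp: finite_subset subset_iff card_insert_if)
  also have "\<dots> = q * (1 + q) ^ card V"
    by (simp add: sum_distrib_left[symmetric] insert.IH)
  finally show ?case
    using insert.hyps disj by (simp add: Pow_insert sum.union_disjoint insert.IH algebra_simps)
qed

text \<open>Weighting each set S by q^|S| bounds the number of sets of size at most m by q^(-m)
  times the total weight (1 + q)^|V|. Fingerprints have size O(q |V|) for the same q, so no binomial
  estimates are required.\<close>

lemma card_small_subsets_le:
  fixes q m :: real
  assumes "finite V" "0 < q" "q \<le> 1"
  shows "real (card (small_subsets V m)) \<le> exp (q * card V + m * ln (1 / q))"
proof -
  have "real (card (small_subsets V m)) = (\<Sum>S\<in>small_subsets V m. 1)"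
    by simp
  also have "\<dots> \<le> (\<Sum>S\<in>small_subsets V m. q ^ card S * exp (m * ln (1 / q)))"
  proof (rule sum_mono)
    fix S assume "S \<in> small_subsets V m"
    then have "real (card S) \<le> m" by (simp add: small_subsets_def)
    then have "0 \<le> (m - card S) * ln (1 / q)" using assms by simp
    then have "1 \<le> exp ((m - card S) * ln (1 / q))" by simp
    also have "(m - card S) * ln (1 / q) = card S * ln q + m * ln (1 / q)"
      using assms by (simp add: ln_div algebra_simps)
    also have "exp \<dots> = q ^ card S * exp (m * ln (1 / q))"
      using assms by (simp add: exp_add exp_of_nat_mult)
    finally show "1 \<le> q ^ card S * exp (m * ln (1 / q))" .
  qed
  also have "\<dots> \<le> (\<Sum>S\<in>Pow V. q ^ card S * exp (m * ln (1 / q)))"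
    using assms by (intro sum_mono2) (auto simp: small_subsets_def)
  also have "\<dots> = (1 + q) ^ card V * exp (m * ln (1 / q))"
    by (simp add: sum_distrib_right[symmetric] sum_Pow_power_card[OF assms(1)])
  also have "\<dots> \<le> exp q ^ card V * exp (m * ln (1 / q))"
    using assms by (intro mult_right_mono power_mono) auto
  also have "\<dots> = exp (q * card V + m * ln (1 / q))"
    by (simp add: exp_add exp_of_nat2_mult)
  finally show ?thesis .
qed

lemma sum_wt_deg:
  fixes w :: "'v set \<Rightarrow> real"
  assumes "finite V" "X \<subseteq> Pow V"
  shows "(\<Sum>T\<in>X. wt_deg V w T) = (\<Sum>e\<in>Pow V. card {T \<in> X. T \<subseteq> e} * w e)"
proof -
  have fX: "finite X" using assms by (meson finite_Pow_iff finite_subset)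
  have "(\<Sum>T\<in>X. wt_deg V w T) = (\<Sum>T\<in>X. \<Sum>e\<in>Pow V. if T \<subseteq> e then w e else 0)"
    unfolding wt_deg_def using assms
    by (intro sum.cong refl sum.mono_neutral_cong_left) auto
  also have "\<dots> = (\<Sum>e\<in>Pow V. \<Sum>T\<in>X. if T \<subseteq> e then w e else 0)"
    by (rule sum.swap)
  also have "\<dots> = (\<Sum>e\<in>Pow V. card {T \<in> X. T \<subseteq> e} * w e)"
    using fX by (intro sum.cong refl) (simp add: sum.inter_filter[symmetric])
  finally show ?thesis .
qed

lemma sum_wt_deg_singletons:
  fixes w :: "'v set \<Rightarrow> real"
  assumes "finite V"
  shows "(\<Sum>v\<in>V. wt_deg V w {v}) = (\<Sum>e\<in>Pow V. card e * w e)"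
proof -
  have "(\<Sum>v\<in>V. wt_deg V w {v}) = (\<Sum>T\<in>(\<lambda>v. {v}) ` V. wt_deg V w T)"
    by (simp add: sum.reindex)
  also have "\<dots> = (\<Sum>e\<in>Pow V. card {T \<in> (\<lambda>v. {v}) ` V. T \<subseteq> e} * w e)"
    by (rule sum_wt_deg) (use assms in auto)
  also have "\<dots> = (\<Sum>e\<in>Pow V. card e * w e)"
  proof (rule sum.cong[OF refl])
    fix e assume "e \<in> Pow V"
    then have "{T \<in> (\<lambda>v. {v}) ` V. T \<subseteq> e} = (\<lambda>v. {v}) ` e" by auto
    then show "card {T \<in> (\<lambda>v. {v}) ` V. T \<subseteq> e} * w e = card e * w e"
      by (simp add: card_image)
  qed
  finally show ?thesis .
qed

text \<open>Every edge has at least one vertex and every vertex has degree at most K. Applied to a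
  link weight of mass at least \<beta> |S|, this is what limits the size of a fingerprint S.\<close>

lemma balanced_total_le:
  fixes w :: "'v set \<Rightarrow> real"
  assumes "finite V" "balanced j V K q w" "j \<ge> 1"
  shows "sum w (Pow V) \<le> K * card V"
proof -
  have "sum w (Pow V) \<le> (\<Sum>e\<in>Pow V. card e * w e)"
  proof (rule sum_mono)
    fix e assume "e \<in> Pow V"
    show "w e \<le> card e * w e"
    proof (cases "w e = 0")
      case False
      then have "card e = j" "w e \<ge> 0" using assms(2) by (auto simp: balanced_def)
      then show ?thesis using assms(3) mult_right_mono[of 1 "real j" "w e"] by simp
    qed simp
  qed
  also have "\<dots> = (\<Sum>v\<in>V. wt_deg V w {v})"
    using sum_wt_deg_singletons[OF assms(1)] by metis
  also have "\<dots> \<le> (\<Sum>v\<in>V. K)"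
  proof (rule sum_mono)
    fix v
    have "wt_deg V w {v} \<le> K * q ^ (card {v} - 1)"
      using assms(2) unfolding balanced_def by blast
    then show "wt_deg V w {v} \<le> K" by simp
  qed
  finally show ?thesis by (simp add: mult.commute)
qed

lemma sum_UN_le:
  fixes f :: "'b \<Rightarrow> 'c::ordered_ab_group_add"
  assumes "finite X" "\<And>T. T \<in> X \<Longrightarrow> finite (A T)" "\<And>x. 0 \<le> f x"
  shows "sum f (\<Union>T\<in>X. A T) \<le> (\<Sum>T\<in>X. sum f (A T))"
  using assms(1,2)
proof (induction X rule: finite_induct)
  case (insert T X)
  have "sum f (A T \<union> (\<Union>T\<in>X. A T)) + sum f (A T \<inter> (\<Union>T\<in>X. A T))
      = sum f (A T) + sum f (\<Union>T\<in>X. A T)"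
    using insert by (intro sum.union_inter) auto
  moreover have "0 \<le> sum f (A T \<inter> (\<Union>T\<in>X. A T))" by (intro sum_nonneg assms(3))
  ultimately have "sum f (A T \<union> (\<Union>T\<in>X. A T)) \<le> sum f (A T) + sum f (\<Union>T\<in>X. A T)"
    by (metis le_add_same_cancel1)
  also have "\<dots> \<le> sum f (A T) + (\<Sum>T\<in>X. sum f (A T))"
    using insert by (intro add_left_mono) auto
  finally show ?case using insert.hyps by simp
qed simp

section \<open>Links of vertices, and the induction on the uniformity\<close>

lemma sum_link:
  assumes "finite V" "v \<in> V"
  shows "(\<Sum>e | e \<subseteq> V \<and> v \<notin> e \<and> P e. g (insert v e)) = (\<Sum>f | f \<subseteq> V \<and> v \<in> f \<and> P (f - {v}). g f)"
  by (rule sum.reindex_bij_witness[where i="\<lambda>f. f - {v}" and j="insert v"])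
     (use assms in \<open>auto simp: insert_absorb\<close>)

text \<open>Each singleton weighs at most K, so the support of \<open>w\<close> has at least (c / K)
  |V| vertices. An independent set misses the whole support, hence a single container
  suffices.\<close>

lemma containers_base:
  fixes w :: "'v set \<Rightarrow> real" and c K q :: real
  assumes "0 < c" "0 < K" and fin: "finite V" and bal: "balanced 1 V K q w"
    and tot: "c * card V \<le> sum w (Pow V)"
  shows "\<exists>C\<subseteq>V. real (card C) \<le> (1 - c / K) * card V \<and> covers V w {C}"
proof -
  define X where "X = {v \<in> V. w {v} \<noteq> 0}"
  have X: "X \<subseteq> V" "finite X" using fin by (auto simp: X_def)
  have "sum w (Pow V) = (\<Sum>e\<in>(\<lambda>v. {v}) ` X. w e)"
  proof (rule sum.mono_neutral_right)
    show "finite (Pow V)" "(\<lambda>v. {v}) ` X \<subseteq> Pow V" using fin X by auto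
    show "\<forall>e\<in>Pow V - (\<lambda>v. {v}) ` X. w e = 0"
    proof
      fix e assume e: "e \<in> Pow V - (\<lambda>v. {v}) ` X"
      show "w e = 0"
      proof (rule ccontr)
        assume "w e \<noteq> 0"
        then have "card e = 1" using bal unfolding balanced_def by blast
        then obtain v where "e = {v}" using card_1_singletonE by blast
        then show False using e \<open>w e \<noteq> 0\<close> by (auto simp: X_def)
      qed
    qed
  qed
  also have "\<dots> = (\<Sum>v\<in>X. w {v})" by (simp add: sum.reindex)
  also have "\<dots> \<le> (\<Sum>v\<in>X. K)"
  proof (rule sum_mono)
    fix v assume "v \<in> X"
    then have v: "v \<in> V" using X by auto
    have "w {v} \<le> wt_deg V w {v}"
      unfolding wt_deg_def using fin v bal by (intro member_le_sum) (auto simp: balanced_def)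
    also have "\<dots> \<le> K * q ^ (card {v} - 1)"
      using bal unfolding balanced_def by blast
    finally show "w {v} \<le> K" by simp
  qed
  finally have "c * card V \<le> K * card X" using tot by (simp add: mult.commute)
  then have le: "c / K * card V \<le> card X" using assms by (simp add: field_simps)
  have "real (card (V - X)) = real (card V) - real (card X)"
    using X fin card_mono[OF fin X(1)] by (simp add: card_Diff_subset of_nat_diff)
  with le have "real (card (V - X)) \<le> (1 - c / K) * card V"
    unfolding left_diff_distrib by linarith
  moreover have "covers V w {V - X}"
    unfolding covers_def X_def by auto
  ultimately show ?thesis by (intro exI[of _ "V - X"]) auto
qed

text \<open>The middle condition makes every \<open>w\<close>-independent set that contains
  \<open>S\<close> independent for \<open>w'\<close> as well. In use, \<open>w'\<close> is only
  asked to exist instead of being built up vertex by vertex, so that being extendable is a property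
  of the set \<open>S\<close> and not of the order in which its elements were added.\<close>

definition link_weighted ::
  "nat \<Rightarrow> 'v set \<Rightarrow> real \<Rightarrow> real \<Rightarrow> real \<Rightarrow> ('v set \<Rightarrow> real) \<Rightarrow> 'v set \<Rightarrow> ('v set \<Rightarrow> real) \<Rightarrow> bool" where
  "link_weighted j V K q \<beta> w S w' \<longleftrightarrow> balanced j V K q w' \<and>
     (\<forall>e. w' e \<noteq> 0 \<longrightarrow> (\<exists>v\<in>S. w (insert v e) \<noteq> 0)) \<and> \<beta> * card S \<le> sum w' (Pow V)"

text \<open>The link of \<open>v\<close>, divided by \<open>q\<close>, gives a set T the degree of T
  + v in \<open>w\<close> over \<open>q\<close>, at most K q^(|T| - 1). Edges containing a saturated
  set are removed from the link first. An unsaturated T then has at most K q^(|T| - 1) from each of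
  the old and the new weight, and a saturated T receives nothing new, so the bound with 2 K
  persists.\<close>

lemma extend_link_weighted:
  fixes w :: "'v set \<Rightarrow> real" and K q :: real
  assumes fin: "finite V" and q: "0 < q" and bal: "balanced (Suc j) V K q w"
    and S: "S \<subseteq> V" and lw: "link_weighted j V (2 * K) q \<beta> w S w'"
    and v: "v \<in> V" "v \<notin> S"
    and sat: "sat = {T. T \<subseteq> V \<and> T \<noteq> {} \<and> K * q ^ (card T - 1) < wt_deg V w' T}"
    and big: "\<beta> * q \<le> (\<Sum>f | f \<subseteq> V \<and> v \<in> f \<and> \<not> (\<exists>T\<in>sat. T \<subseteq> f - {v}). w f)"
  shows "\<exists>w''. link_weighted j V (2 * K) q \<beta> w (insert v S) w''"
proof -
  define u where "u e = (if e \<subseteq> V \<and> v \<notin> e \<and> \<not> (\<exists>T\<in>sat. T \<subseteq> e) then w (insert v e) / q else 0)" for e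
  define w'' where "w'' e = w' e + u e" for e
  have w0: "0 \<le> w e" for e using bal by (simp add: balanced_def)
  have u0: "0 \<le> u e" for e using w0 q by (simp add: u_def)
  have bal': "balanced j V (2 * K) q w'" using lw by (simp add: link_weighted_def)
  have deg_w'': "wt_deg V w'' T = wt_deg V w' T + wt_deg V u T" for T
    by (simp add: wt_deg_def w''_def sum.distrib)
  have deg_u: "wt_deg V u T \<le> K * q ^ (card T - 1)" if T: "T \<noteq> {}" "T \<notin> sat" "T \<subseteq> V" for T
  proof -
    have K: "0 \<le> K"
    proof -
      have "0 \<le> wt_deg V w {v}" unfolding wt_deg_def using w0 by (simp add: sum_nonneg)
      also have "\<dots> \<le> K * q ^ (card {v} - 1)" using bal unfolding balanced_def by blast
      finally show ?thesis by simp
    qed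
    show ?thesis
    proof (cases "v \<in> T")
      case True
      then have "wt_deg V u T = 0"
        unfolding wt_deg_def by (intro sum.neutral) (auto simp: u_def)
      then show ?thesis using K q by simp
    next
      case False
      have fT: "finite T" using T fin finite_subset by auto
      have "wt_deg V u T \<le> (\<Sum>e | e \<subseteq> V \<and> v \<notin> e \<and> T \<subseteq> e. w (insert v e) / q)"
      proof -
        have "wt_deg V u T = (\<Sum>e | e \<subseteq> V \<and> v \<notin> e \<and> T \<subseteq> e. u e)"
          unfolding wt_deg_def using fin by (intro sum.mono_neutral_right) (auto simp: u_def)
        also have "\<dots> \<le> (\<Sum>e | e \<subseteq> V \<and> v \<notin> e \<and> T \<subseteq> e. w (insert v e) / q)"
          using w0 q by (intro sum_mono) (auto simp: u_def)
        finally show ?thesis .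
      qed
      also have "\<dots> = (\<Sum>f | f \<subseteq> V \<and> v \<in> f \<and> T \<subseteq> f - {v}. w f / q)"
        by (rule sum_link[OF fin v(1)])
      also have "{f. f \<subseteq> V \<and> v \<in> f \<and> T \<subseteq> f - {v}} = {f. f \<subseteq> V \<and> insert v T \<subseteq> f}"
        using False by auto
      also have "(\<Sum>f | f \<subseteq> V \<and> insert v T \<subseteq> f. w f / q) = wt_deg V w (insert v T) / q"
        by (simp add: wt_deg_def sum_divide_distrib)
      also have "\<dots> \<le> K * q ^ (card (insert v T) - 1) / q"
        using bal q unfolding balanced_def by (intro divide_right_mono) auto
      also have "\<dots> = K * q ^ (card T - 1)"
      proof -
        have "card T > 0" using fT T by (simp add: card_gt_0_iff)
        then obtain m where "card T = Suc m" using gr0_conv_Suc by auto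
        then show ?thesis using False fT q by simp
      qed
      finally show ?thesis .
    qed
  qed
  have "balanced j V (2 * K) q w''"
    unfolding balanced_def
  proof (intro conjI allI impI)
    fix e show "0 \<le> w'' e" using bal' u0 by (simp add: w''_def balanced_def)
  next
    fix e assume "w'' e \<noteq> 0"
    then have "w' e \<noteq> 0 \<or> u e \<noteq> 0" by (auto simp: w''_def)
    moreover have "e \<subseteq> V \<and> card e = j" if "w' e \<noteq> 0"
      using that bal' by (auto simp: balanced_def)
    moreover have "e \<subseteq> V \<and> card e = j" if "u e \<noteq> 0"
    proof -
      have e: "e \<subseteq> V" "v \<notin> e" "w (insert v e) \<noteq> 0" using that by (auto simp: u_def split: if_splits)
      then have "card (insert v e) = Suc j" using bal unfolding balanced_def by blast
      moreover have "finite e" using e fin finite_subset by auto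
      ultimately show ?thesis using e by simp
    qed
    ultimately show "e \<subseteq> V" "card e = j" by auto
  next
    fix T :: "'v set" assume T: "T \<noteq> {}"
    show "wt_deg V w'' T \<le> 2 * K * q ^ (card T - 1)"
    proof (cases "T \<in> sat \<or> \<not> T \<subseteq> V")
      case True
      then have "wt_deg V u T = 0"
        unfolding wt_deg_def by (intro sum.neutral) (auto simp: u_def)
      then show ?thesis using bal' T by (simp add: deg_w'' balanced_def)
    next
      case False
      then have "wt_deg V w' T \<le> K * q ^ (card T - 1)" using T sat by auto
      with deg_u[of T] False T show ?thesis by (simp add: deg_w'')
    qed
  qed
  moreover have "\<exists>x\<in>insert v S. w (insert x e) \<noteq> 0" if "w'' e \<noteq> 0" for e
  proof -
    have "w' e \<noteq> 0 \<or> u e \<noteq> 0" using that by (auto simp: w''_def)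
    then show ?thesis using lw by (auto simp: u_def link_weighted_def split: if_splits)
  qed
  moreover have "\<beta> * card (insert v S) \<le> sum w'' (Pow V)"
  proof -
    have "sum u (Pow V) = (\<Sum>e | e \<subseteq> V \<and> v \<notin> e \<and> \<not> (\<exists>T\<in>sat. T \<subseteq> e). w (insert v e) / q)"
      using fin by (intro sum.mono_neutral_cong_right) (auto simp: u_def)
    also have "\<dots> = (\<Sum>f | f \<subseteq> V \<and> v \<in> f \<and> \<not> (\<exists>T\<in>sat. T \<subseteq> f - {v}). w f / q)"
      by (rule sum_link[OF fin v(1)])
    also have "\<dots> \<ge> \<beta>"
      using big q by (simp add: sum_divide_distrib[symmetric] field_simps)
    finally have "\<beta> \<le> sum u (Pow V)" .
    moreover have "card (insert v S) = card S + 1"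
      using v S fin by (simp add: finite_subset)
    ultimately show ?thesis
      using lw by (simp add: link_weighted_def w''_def sum.distrib algebra_simps)
  qed
  ultimately show ?thesis unfolding link_weighted_def by blast
qed

text \<open>If most vertices were unextendable, then most of the weight would lie on edges containing a
  saturated set. A saturated set has larger degree in \<open>w'\<close> than in \<open>w\<close>, so that this weight is at
  most \<open>(j + 1) 2 ^ j\<close> times the total of \<open>w'\<close>, which is small.\<close>

lemma few_unextendable:
  fixes w :: "'v set \<Rightarrow> real" and c K q :: real
  assumes fin: "finite V" and q: "0 < q" and c: "0 < c" and K: "0 < K" and j: "1 \<le> j"
    and bal: "balanced (Suc j) V K q w" and tot: "c * card V \<le> sum w (Pow V)"
    and S: "S \<subseteq> V" and lw: "link_weighted j V (2 * K) q (c / (4 * q)) w S w'"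
    and small: "sum w' (Pow V) \<le> c / 2 ^ (j + 1) * card V"
  shows "real (card {v \<in> V - S. \<not> (\<exists>w''. link_weighted j V (2 * K) q (c / (4 * q)) w (insert v S) w'')})
    \<le> (1 - c / (4 * K)) * card V"
proof -
  define A where "A = {v \<in> V - S. \<not> (\<exists>w''. link_weighted j V (2 * K) q (c / (4 * q)) w (insert v S) w'')}"
  define sat where "sat = {T. T \<subseteq> V \<and> T \<noteq> {} \<and> K * q ^ (card T - 1) < wt_deg V w' T}"
  define bad where "bad v f \<longleftrightarrow> (\<exists>T\<in>sat. T \<subseteq> f - {v})" for v f
  have w0: "0 \<le> w e" for e using bal by (simp add: balanced_def)
  have bal': "balanced j V (2 * K) q w'" using lw by (simp add: link_weighted_def)
  have w'0: "0 \<le> w' e" for e using bal' by (simp add: balanced_def)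
  have fsat: "finite sat" "sat \<subseteq> Pow V" using fin by (auto simp: sat_def)
  have A: "A \<subseteq> V" "finite A" using fin by (auto simp: A_def)
  \<comment> \<open>Here \<beta> q = c / 4: a vertex whose link has more than this weight on edges
    free of saturated sets could be added to \<open>S\<close>.\<close>
  have unsat: "(\<Sum>f | f \<subseteq> V \<and> v \<in> f \<and> \<not> bad v f. w f) \<le> c / 4" if "v \<in> A" for v
  proof (rule ccontr)
    assume "\<not> ?thesis"
    then have "c / (4 * q) * q \<le> (\<Sum>f | f \<subseteq> V \<and> v \<in> f \<and> \<not> (\<exists>T\<in>sat. T \<subseteq> f - {v}). w f)"
      using q by (simp add: bad_def)
    from extend_link_weighted[OF fin q bal S lw _ _ sat_def this] that
    show False by (auto simp: A_def)
  qed
  have "(\<Sum>v\<in>V. \<Sum>f | f \<subseteq> V \<and> v \<in> f \<and> bad v f. w f)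
      \<le> (\<Sum>v\<in>V. \<Sum>T\<in>sat. \<Sum>f | f \<subseteq> V \<and> v \<in> f \<and> T \<subseteq> f. w f)"
  proof (rule sum_mono)
    fix v
    have "(\<Sum>f | f \<subseteq> V \<and> v \<in> f \<and> bad v f. w f)
        \<le> (\<Sum>f\<in>(\<Union>T\<in>sat. {f. f \<subseteq> V \<and> v \<in> f \<and> T \<subseteq> f}). w f)"
      using fin w0 fsat by (intro sum_mono2) (auto simp: bad_def)
    also have "\<dots> \<le> (\<Sum>T\<in>sat. \<Sum>f | f \<subseteq> V \<and> v \<in> f \<and> T \<subseteq> f. w f)"
      using fin w0 fsat by (intro sum_UN_le) auto
    finally show "(\<Sum>f | f \<subseteq> V \<and> v \<in> f \<and> bad v f. w f)
        \<le> (\<Sum>T\<in>sat. \<Sum>f | f \<subseteq> V \<and> v \<in> f \<and> T \<subseteq> f. w f)" .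
  qed
  also have "\<dots> = (\<Sum>T\<in>sat. \<Sum>v\<in>V. \<Sum>f | f \<subseteq> V \<and> v \<in> f \<and> T \<subseteq> f. w f)"
    by (rule sum.swap)
  also have "\<dots> \<le> (\<Sum>T\<in>sat. (j + 1) * wt_deg V w' T)"
  proof (rule sum_mono)
    fix T assume T: "T \<in> sat"
    define g where "g f = (if T \<subseteq> f then w f else 0)" for f
    have "(\<Sum>v\<in>V. \<Sum>f | f \<subseteq> V \<and> v \<in> f \<and> T \<subseteq> f. w f) = (\<Sum>v\<in>V. wt_deg V g {v})"
      unfolding wt_deg_def g_def using fin
      by (intro sum.cong refl sum.mono_neutral_cong_left) auto
    also have "\<dots> = (\<Sum>f\<in>Pow V. card f * g f)" by (rule sum_wt_deg_singletons[OF fin])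
    also have "\<dots> = (\<Sum>f\<in>Pow V. (j + 1) * g f)"
      using bal by (intro sum.cong refl) (auto simp: g_def balanced_def)
    also have "\<dots> = (j + 1) * wt_deg V w T"
      unfolding sum_distrib_left[symmetric] wt_deg_def g_def using fin
      by (subst sum.mono_neutral_cong_right[of "Pow V" "{e. e \<subseteq> V \<and> T \<subseteq> e}"]) auto
    also have "wt_deg V w T \<le> wt_deg V w' T"
    proof -
      have "wt_deg V w T \<le> K * q ^ (card T - 1)"
        using bal T by (simp add: balanced_def sat_def)
      also have "\<dots> \<le> wt_deg V w' T" using T by (simp add: sat_def)
      finally show ?thesis .
    qed
    finally show "(\<Sum>v\<in>V. \<Sum>f | f \<subseteq> V \<and> v \<in> f \<and> T \<subseteq> f. w f) \<le> (j + 1) * wt_deg V w' T"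
      by (simp add: mult_left_mono)
  qed
  also have "\<dots> = (j + 1) * (\<Sum>e\<in>Pow V. card {T \<in> sat. T \<subseteq> e} * w' e)"
    by (simp add: sum_distrib_left[symmetric] sum_wt_deg[OF fin fsat(2)])
  also have "\<dots> \<le> (j + 1) * (\<Sum>e\<in>Pow V. 2 ^ j * w' e)"
  proof (intro mult_left_mono sum_mono)
    fix e assume e: "e \<in> Pow V"
    show "card {T \<in> sat. T \<subseteq> e} * w' e \<le> 2 ^ j * w' e"
    proof (cases "w' e = 0")
      case False
      then have ce: "card e = j" using bal' by (auto simp: balanced_def)
      have fe: "finite e" using e fin finite_subset by auto
      have "card {T \<in> sat. T \<subseteq> e} \<le> card (Pow e)"
        using fe by (intro card_mono) auto
      then have "card {T \<in> sat. T \<subseteq> e} \<le> 2 ^ j" using ce fe by (simp add: card_Pow)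
      then have "real (card {T \<in> sat. T \<subseteq> e}) \<le> real (2 ^ j)" by (rule of_nat_mono)
      then have "real (card {T \<in> sat. T \<subseteq> e}) \<le> 2 ^ j" by simp
      then show ?thesis using w'0 by (rule mult_right_mono)
    qed simp
  qed auto
  also have "\<dots> = (j + 1) * (2 ^ j * sum w' (Pow V))" by (simp add: sum_distrib_left)
  also have "\<dots> \<le> (j + 1) * (2 ^ j * (c / 2 ^ (j + 1) * card V))"
    using small by (intro mult_left_mono) auto
  also have "\<dots> = (j + 1) * c * card V / 2" by simp
  finally have satsum: "(\<Sum>v\<in>V. \<Sum>f | f \<subseteq> V \<and> v \<in> f \<and> bad v f. w f) \<le> (j + 1) * c * card V / 2" .
  have split: "wt_deg V w {v} = (\<Sum>f | f \<subseteq> V \<and> v \<in> f \<and> \<not> bad v f. w f)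
      + (\<Sum>f | f \<subseteq> V \<and> v \<in> f \<and> bad v f. w f)" for v
    unfolding wt_deg_def using fin by (subst sum.union_disjoint[symmetric]) (auto intro: sum.cong)
  have deg1: "wt_deg V w {v} \<le> K" for v
  proof -
    have "wt_deg V w {v} \<le> K * q ^ (card {v} - 1)" using bal unfolding balanced_def by blast
    then show ?thesis by simp
  qed
  have unsat_le: "(\<Sum>f | f \<subseteq> V \<and> v \<in> f \<and> \<not> bad v f. w f) \<le> K" for v
    using split[of v] deg1[of v] w0 sum_nonneg[of "{f. f \<subseteq> V \<and> v \<in> f \<and> bad v f}" w] by simp
  have "(j + 1) * (c * card V) \<le> (j + 1) * sum w (Pow V)"
    using tot by (intro mult_left_mono) auto
  also have "\<dots> = (\<Sum>f\<in>Pow V. card f * w f)"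
    unfolding sum_distrib_left using bal by (intro sum.cong refl) (auto simp: balanced_def)
  also have "\<dots> = (\<Sum>v\<in>V. wt_deg V w {v})"
    using sum_wt_deg_singletons[OF fin, of w] by simp
  also have "\<dots> = (\<Sum>v\<in>V. \<Sum>f | f \<subseteq> V \<and> v \<in> f \<and> \<not> bad v f. w f)
      + (\<Sum>v\<in>V. \<Sum>f | f \<subseteq> V \<and> v \<in> f \<and> bad v f. w f)"
    by (simp add: split sum.distrib)
  also have "\<dots> \<le> (\<Sum>v\<in>V. \<Sum>f | f \<subseteq> V \<and> v \<in> f \<and> \<not> bad v f. w f) + (j + 1) * c * card V / 2"
    using satsum by simp
  also have "(\<Sum>v\<in>V. \<Sum>f | f \<subseteq> V \<and> v \<in> f \<and> \<not> bad v f. w f)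
      \<le> (\<Sum>v\<in>V. if v \<in> A then c / 4 else K)"
    using unsat unsat_le by (intro sum_mono) auto
  also have "\<dots> = (\<Sum>v\<in>A. c / 4) + (\<Sum>v\<in>V - A. K)"
    using A fin by (subst sum.If_cases) (auto simp: Int_absorb1 Diff_eq)
  also have "\<dots> = c / 4 * card A + K * (real (card V) - real (card A))"
    using A fin card_mono[OF fin A(1)] by (simp add: card_Diff_subset of_nat_diff)
  finally have 1: "(real j + 1) * (c * card V) / 2 \<le> c / 4 * card A + K * (real (card V) - card A)"
    by (simp add: field_simps)
  have "card A \<le> card V" using A fin by (simp add: card_mono)
  then have "c / 4 * card A \<le> c / 4 * card V" using c by simp
  \<comment> \<open>Because j \<ge> 1, half of the degree sum (j + 1) c |V| is still at least c |V|.
    Vertices of \<open>A\<close> account for at most (c / 4) |V| of it, so the others, of degree at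
    most K each, must be numerous.\<close>
  moreover have "2 * (c * card V) / 2 \<le> (real j + 1) * (c * card V) / 2"
    using j c by (intro divide_right_mono mult_right_mono) auto
  moreover have "0 \<le> c * card V" using c by simp
  ultimately have "c / 4 * card V \<le> K * (real (card V) - card A)"
    using 1 by linarith
  then have "c / (4 * K) * card V \<le> real (card V) - card A"
    using K by (simp add: field_simps)
  then show ?thesis unfolding A_def by (simp add: algebra_simps)
qed

text \<open>Passing to a link weight doubles K and divides c by 2^(j + 1) while the vertex set stays
  the same, so \<delta> and B depend on k, c and K only. Each level of the induction contributes at
  most one factor for the choice of a fingerprint, whence the exponent k.\<close>

lemma containers:
  fixes c K :: real
  assumes "1 \<le> k" "0 < c" "0 < K"
  shows "\<exists>\<delta> B. 0 < \<delta> \<and> \<delta> < 1 \<and> 0 < B \<and> (\<forall>(V::'v set) (w::'v set \<Rightarrow> real) (q::real). finite V \<longrightarrow> 0 < q \<longrightarrow> B * q \<le> \<delta> \<longrightarrow>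
     balanced k V K q w \<longrightarrow> c * card V \<le> sum w (Pow V) \<longrightarrow>
     (\<exists>\<C>. finite \<C> \<and> card \<C> \<le> card (small_subsets V (B * q * card V)) ^ k \<and>
        (\<forall>C\<in>\<C>. C \<subseteq> V \<and> real (card C) \<le> (1 - \<delta>) * card V) \<and> covers V w \<C>))"
  using assms
proof (induction k arbitrary: c K rule: dec_induct)
  case base
  define \<delta> where "\<delta> = min (c / K) (1 / 2)"
  have \<delta>: "0 < \<delta>" "\<delta> < 1" "\<delta> \<le> c / K" using base by (auto simp: \<delta>_def)
  show ?case
  proof (rule exI[of _ \<delta>], rule exI[of _ 1], intro conjI \<delta> allI impI)
    fix V :: "'v set" and w :: "'v set \<Rightarrow> real" and q :: real
    assume A: "finite V" "0 < q" "balanced 1 V K q w" "c * card V \<le> sum w (Pow V)"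
    from containers_base[OF base A(1,3,4)] obtain C where C: "C \<subseteq> V"
      "real (card C) \<le> (1 - c / K) * card V" "covers V w {C}" by blast
    have "{} \<in> small_subsets V (1 * q * card V)" using A by (simp add: small_subsets_def)
    then have "1 \<le> card (small_subsets V (1 * q * card V))"
      using A(1) by (metis One_nat_def Suc_leI card_gt_0_iff empty_iff finite_small_subsets)
    moreover have "(1 - c / K) * card V \<le> (1 - \<delta>) * card V"
      using \<delta> by (intro mult_right_mono) auto
    ultimately show "\<exists>\<C>. finite \<C> \<and> card \<C> \<le> card (small_subsets V (1 * q * card V)) ^ 1 \<and>
        (\<forall>C\<in>\<C>. C \<subseteq> V \<and> real (card C) \<le> (1 - \<delta>) * card V) \<and> covers V w \<C>"
      using C by (intro exI[of _ "{C}"]) auto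
  qed simp
next
  case (step j)
  have "0 < c / 2 ^ (j + 1)" "0 < 2 * K" using step by auto
  from step.IH[OF this] obtain \<delta>' B' where IH: "0 < \<delta>'" "\<delta>' < 1" "0 < B'"
    "\<And>(V::'v set) (w::'v set \<Rightarrow> real) (q::real). finite V \<Longrightarrow> 0 < q \<Longrightarrow> B' * q \<le> \<delta>' \<Longrightarrow>
     balanced j V (2 * K) q w \<Longrightarrow> c / 2 ^ (j + 1) * card V \<le> sum w (Pow V) \<Longrightarrow>
     (\<exists>\<C>. finite \<C> \<and> card \<C> \<le> card (small_subsets V (B' * q * card V)) ^ j \<and>
        (\<forall>C\<in>\<C>. C \<subseteq> V \<and> real (card C) \<le> (1 - \<delta>') * card V) \<and> covers V w \<C>)"
    by blast
  \<comment> \<open>The value c / (8 K) is half of the proportion c / (4 K) of extending vertices;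
    the other half pays for putting \<open>S\<close>, of size at most B q |V| \<le> \<delta> |V|,
    back into the container. The value 8 K / c comes from (c / (4 q)) |S| \<le> 2 K |V|.\<close>
  define \<delta> where "\<delta> = min \<delta>' (c / (8 * K))"
  define B where "B = max B' (8 * K / c)"
  have \<delta>: "0 < \<delta>" "\<delta> < 1" "\<delta> \<le> \<delta>'" "\<delta> \<le> c / (8 * K)" using step IH by (auto simp: \<delta>_def)
  have B: "0 < B" "B' \<le> B" "8 * K / c \<le> B" using IH by (auto simp: B_def)
  show ?case
  proof (rule exI[of _ \<delta>], rule exI[of _ B], intro conjI \<delta> B allI impI)
    fix V :: "'v set" and w :: "'v set \<Rightarrow> real" and q :: real
    assume V: "finite V" and q: "0 < q" and Bq: "B * q \<le> \<delta>"
      and bal: "balanced (Suc j) V K q w" and tot: "c * card V \<le> sum w (Pow V)"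
    define \<beta> where "\<beta> = c / (4 * q)"
    define Q where "Q S \<longleftrightarrow> S \<subseteq> V \<and> (\<exists>w'. link_weighted j V (2 * K) q \<beta> w S w')" for S
    define P where "P = small_subsets V (B * q * card V)"
    have fP: "finite P" using V by (simp add: P_def)
    have QP: "S \<in> P" if QS: "Q S" for S
    proof -
      obtain w' where w': "S \<subseteq> V" "link_weighted j V (2 * K) q \<beta> w S w'"
        using QS by (auto simp: Q_def)
      then have "\<beta> * card S \<le> 2 * K * card V"
        using balanced_total_le[OF V, of j "2 * K" q w'] step by (auto simp: link_weighted_def)
      then have "real (card S) \<le> 8 * K / c * q * card V"
        using q step by (simp add: \<beta>_def field_simps)
      also have "\<dots> \<le> B * q * card V"
        using B q by (intro mult_right_mono) auto
      finally show ?thesis using w' by (simp add: P_def small_subsets_def)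
    qed
    \<comment> \<open>The family only has to serve those independent \<open>I\<close> in which
      \<open>S\<close> cannot be enlarged inside \<open>I\<close>; every independent set has such an
      \<open>S\<close>.\<close>
    have ex: "\<exists>\<C>. finite \<C> \<and> card \<C> \<le> card P ^ j \<and> (\<forall>C\<in>\<C>. C \<subseteq> V \<and> real (card C) \<le> (1 - \<delta>) * card V) \<and>
        (\<forall>I\<subseteq>V. S \<subseteq> I \<longrightarrow> (\<forall>v\<in>I - S. \<not> Q (insert v S)) \<longrightarrow> (\<forall>e. w e \<noteq> 0 \<longrightarrow> \<not> e \<subseteq> I)
           \<longrightarrow> (\<exists>C\<in>\<C>. I \<subseteq> C))" if QS: "Q S" for S
    proof -
      obtain w' where S: "S \<subseteq> V" and w': "link_weighted j V (2 * K) q \<beta> w S w'"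
        using QS by (auto simp: Q_def)
      show ?thesis
      proof (cases "c / 2 ^ (j + 1) * card V \<le> sum w' (Pow V)")
        case True
        have "B' * q \<le> \<delta>'" using Bq B \<delta> q mult_right_mono[of B' B q] by linarith
        with IH(4)[OF V q _ _ True] w' obtain \<C> where \<C>: "finite \<C>"
          "card \<C> \<le> card (small_subsets V (B' * q * card V)) ^ j"
          "\<And>C. C \<in> \<C> \<Longrightarrow> C \<subseteq> V \<and> real (card C) \<le> (1 - \<delta>') * card V" "covers V w' \<C>"
          by (auto simp: link_weighted_def)
        have "card (small_subsets V (B' * q * card V)) \<le> card P"
          unfolding P_def using V B q
          by (intro card_mono small_subsets_mono mult_right_mono) auto
        then have "card \<C> \<le> card P ^ j" using \<C>(2) by (meson le_trans power_mono zero_le)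
        moreover have small: "C \<subseteq> V" "real (card C) \<le> (1 - \<delta>) * card V" if "C \<in> \<C>" for C
        proof -
          have "(1 - \<delta>') * card V \<le> (1 - \<delta>) * card V" using \<delta> by (intro mult_right_mono) auto
          then show "C \<subseteq> V" "real (card C) \<le> (1 - \<delta>) * card V"
            using \<C>(3)[OF that] by auto
        qed
        moreover have cov: "\<exists>C\<in>\<C>. I \<subseteq> C" if I: "I \<subseteq> V" "S \<subseteq> I" "\<forall>e. w e \<noteq> 0 \<longrightarrow> \<not> e \<subseteq> I" for I
        proof -
          have "\<not> e \<subseteq> I" if e: "w' e \<noteq> 0" for e
          proof
            assume "e \<subseteq> I"
            obtain v where "v \<in> S" "w (insert v e) \<noteq> 0"
              using w' e by (auto simp: link_weighted_def)
            then show False using I \<open>e \<subseteq> I\<close> by auto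
          qed
          then show ?thesis using \<C>(4) I(1) by (auto simp: covers_def)
        qed
        ultimately show ?thesis
          using \<C>(1) by (intro exI[of _ \<C>] conjI ballI allI impI) simp_all
      next
        case False
        define A where "A = {v \<in> V - S. \<not> (\<exists>w''. link_weighted j V (2 * K) q \<beta> w (insert v S) w'')}"
        have "real (card A) \<le> (1 - c / (4 * K)) * card V"
          unfolding A_def \<beta>_def
          by (rule few_unextendable[OF V q step.prems(1,2) step.hyps(1) bal tot S, of w'])
             (use w' False in \<open>auto simp: \<beta>_def\<close>)
        moreover have "real (card S) \<le> \<delta> * card V"
        proof -
          have "real (card S) \<le> B * q * card V" using QP[OF QS] by (simp add: P_def small_subsets_def)
          also have "\<dots> \<le> \<delta> * card V" using Bq by (intro mult_right_mono) auto
          finally show ?thesis .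
        qed
        moreover have "real (card (A \<union> S)) \<le> real (card A) + card S"
          using card_Un_le[of A S] by linarith
        moreover have "c / (4 * K) * card V \<ge> 2 * \<delta> * card V"
          using \<delta> by (intro mult_right_mono) auto
        ultimately have "real (card (A \<union> S)) \<le> (1 - \<delta>) * card V"
          by (simp add: algebra_simps)
        moreover have "1 \<le> card P ^ j"
          using QP[OF QS] fP by (metis One_nat_def Suc_leI card_gt_0_iff empty_iff zero_less_power)
        moreover have "I \<subseteq> A \<union> S" if "I \<subseteq> V" "S \<subseteq> I" "\<forall>v\<in>I - S. \<not> Q (insert v S)" for I
          using that S by (auto simp: A_def Q_def)
        moreover have "A \<union> S \<subseteq> V" using S by (auto simp: A_def)
        ultimately show ?thesis by (intro exI[of _ "{A \<union> S}"]) auto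
      qed
    qed
    \<comment> \<open>The choice depends on \<open>S\<close> but neither on \<open>I\<close> nor on
      a particular link weight, so the number of families is at most the number of
      fingerprints.\<close>
    define F where "F S = (SOME \<C>. finite \<C> \<and> card \<C> \<le> card P ^ j \<and> (\<forall>C\<in>\<C>. C \<subseteq> V \<and> real (card C) \<le> (1 - \<delta>) * card V) \<and>
        (\<forall>I\<subseteq>V. S \<subseteq> I \<longrightarrow> (\<forall>v\<in>I - S. \<not> Q (insert v S)) \<longrightarrow> (\<forall>e. w e \<noteq> 0 \<longrightarrow> \<not> e \<subseteq> I)
           \<longrightarrow> (\<exists>C\<in>\<C>. I \<subseteq> C)))" for S
    note F = someI_ex[OF ex, folded F_def]
    define QQ where "QQ = {S. Q S}"
    have QQ: "QQ \<subseteq> P" "finite QQ" using QP fP finite_subset[of QQ P] by (auto simp: QQ_def)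
    define \<C> where "\<C> = (\<Union>S\<in>QQ. F S)"
    have "finite \<C>" unfolding \<C>_def using QQ F by (auto simp: QQ_def)
    moreover have "card \<C> \<le> card P ^ Suc j"
    proof -
      have "card \<C> \<le> (\<Sum>S\<in>QQ. card (F S))" unfolding \<C>_def using QQ by (intro card_UN_le)
      also have "\<dots> \<le> (\<Sum>S\<in>QQ. card P ^ j)" using F by (intro sum_mono) (auto simp: QQ_def)
      also have "\<dots> = card QQ * card P ^ j" by simp
      also have "\<dots> \<le> card P * card P ^ j"
        using QQ fP by (intro mult_right_mono card_mono) auto
      finally show ?thesis by simp
    qed
    moreover have "\<forall>C\<in>\<C>. C \<subseteq> V \<and> real (card C) \<le> (1 - \<delta>) * card V"
      unfolding \<C>_def QQ_def using F by blast
    moreover have "covers V w \<C>"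
      unfolding covers_def
    proof (intro allI impI)
      fix I assume I: "I \<subseteq> V" "\<forall>e. w e \<noteq> 0 \<longrightarrow> \<not> e \<subseteq> I"
      \<comment> \<open>The zero weight witnesses the empty fingerprint, so maximal fingerprints
        inside \<open>I\<close> exist.\<close>
      have "Q {}"
        unfolding Q_def link_weighted_def balanced_def wt_deg_def
        using step q by (auto intro!: exI[of _ "\<lambda>_. 0"])
      then have "{S. Q S \<and> S \<subseteq> I} \<noteq> {}" by auto
      moreover have "finite {S. Q S \<and> S \<subseteq> I}" using QQ(2) by (rule finite_subset[rotated]) (auto simp: QQ_def)
      ultimately obtain S where S: "S \<in> {S. Q S \<and> S \<subseteq> I}"
        and max: "\<And>S'. S' \<in> {S. Q S \<and> S \<subseteq> I} \<Longrightarrow> S \<subseteq> S' \<Longrightarrow> S = S'"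
        using finite_has_maximal by metis
      have "\<not> Q (insert v S)" if "v \<in> I - S" for v
        using max[of "insert v S"] S that by auto
      then have "\<exists>C\<in>F S. I \<subseteq> C"
        using F[of S] S I by blast
      then show "\<exists>C\<in>\<C>. I \<subseteq> C" using S by (auto simp: \<C>_def QQ_def)
    qed
    ultimately show "\<exists>\<C>. finite \<C> \<and> card \<C> \<le> card (small_subsets V (B * q * card V)) ^ Suc j \<and>
        (\<forall>C\<in>\<C>. C \<subseteq> V \<and> real (card C) \<le> (1 - \<delta>) * card V) \<and> covers V w \<C>"
      unfolding P_def by (intro exI[of _ \<C>] conjI)
  qed
qed

section \<open>Balanced families of copies\<close>

lemma copies_subset: "A \<in> copies H G \<Longrightarrow> A \<subseteq> edges G"
  by (auto simp: copies_def)

lemma copies_mono: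
  "verts G \<subseteq> verts G' \<Longrightarrow> edges G \<subseteq> edges G' \<Longrightarrow> copies H G \<subseteq> copies H G'"
  unfolding copies_def by (intro Collect_mono ex_mono impI conjI; elim conjE) (simp_all; (erule order_trans; assumption))+

lemma uniform_finite_edges: "uniform_hypergraph r G \<Longrightarrow> finite (edges G)"
  unfolding uniform_hypergraph_def by (rule finite_subset[of _ "Pow (verts G)"]) auto

lemma finite_copies: "uniform_hypergraph r G \<Longrightarrow> finite (copies H G)"
  by (rule finite_subset[of _ "Pow (edges G)"]) (auto dest: copies_subset uniform_finite_edges)

text \<open>Density conditions are stated for sets of edges of \<open>H\<close>, saturation for sets
  of edges of \<open>G\<close>. An embedding is injective on vertices, hence on edges, so pulling
  \<open>T\<close> back preserves both counts that enter the density. The last clause yields the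
  size of a full copy.\<close>

lemma subset_copy_preimage:
  assumes H: "uniform_hypergraph r H" and A: "A \<in> copies H G" and T: "T \<subseteq> A"
  obtains F where "F \<subseteq> edges H" "card F = card T" "card (\<Union>F) = card (\<Union>T)" "F = {} \<longleftrightarrow> T = {}"
    "T = A \<Longrightarrow> F = edges H"
proof -
  obtain \<phi> where \<phi>: "inj_on \<phi> (verts H)" "A = (\<lambda>e. \<phi> ` e) ` edges H"
    using A by (auto simp: copies_def)
  have sub: "edges H \<subseteq> Pow (verts H)" using H by (auto simp: uniform_hypergraph_def)
  have inj: "inj_on (image \<phi>) (edges H)"
    using inj_on_image_Pow[OF \<phi>(1)] sub inj_on_subset by blast
  define F where "F = {e \<in> edges H. \<phi> ` e \<in> T}"
  have TF: "T = (image \<phi>) ` F" using T \<phi>(2) by (auto simp: F_def)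
  have F: "F \<subseteq> edges H" by (auto simp: F_def)
  show ?thesis
  proof (rule that[of F])
    show "card F = card T" unfolding TF using inj F by (metis card_image inj_on_subset)
    have "\<Union>T = \<phi> ` (\<Union>F)" unfolding TF by auto
    moreover have "\<Union>F \<subseteq> verts H" using F sub by auto
    then have "inj_on \<phi> (\<Union>F)" by (rule inj_on_subset[OF \<phi>(1)])
    ultimately show "card (\<Union>F) = card (\<Union>T)" by (simp add: card_image)
    show "F = {} \<longleftrightarrow> T = {}" unfolding TF by auto
    show "F = edges H" if "T = A" using that \<phi>(2) by (auto simp: F_def)
  qed (rule F)
qed

lemma card_copy:
  assumes "uniform_hypergraph r H" "A \<in> copies H G"
  shows "card A = card (edges H)"
  using subset_copy_preimage[OF assms order_refl] by metis

lemma card_edges_le_choose: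
  assumes "uniform_hypergraph r G"
  shows "card (edges G) \<le> card (verts G) choose r"
proof -
  have f: "finite (verts G)" using assms by (simp add: uniform_hypergraph_def)
  have "card (edges G) \<le> card {e. e \<subseteq> verts G \<and> card e = r}"
    using assms f by (intro card_mono) (auto simp: uniform_hypergraph_def)
  then show ?thesis using n_subsets[OF f] by simp
qed

lemma card_edges_le_ex_num:
  fixes G :: "nat hypergraph"
  assumes "uniform_hypergraph r G" "hfree H G"
  shows "card (edges G) \<le> ex_num r (card (verts G)) H"
  unfolding ex_num_def
proof (rule Max_ge)
  show "finite {card (edges G') | G' :: nat hypergraph. uniform_hypergraph r G' \<and>
      card (verts G') = card (verts G) \<and> hfree H G'}"
    by (rule finite_subset[of _ "{.. card (verts G) choose r}"])
       (auto dest: card_edges_le_choose)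
  show "card (edges G) \<in> {card (edges G') | G' :: nat hypergraph. uniform_hypergraph r G' \<and>
      card (verts G') = card (verts G) \<and> hfree H G'}"
    using assms by auto
qed

section \<open>Sampling a vertex set of fixed size\<close>

lemma card_supersets_of_card:
  assumes "finite V" "A \<subseteq> V" "card A \<le> s"
  shows "card {S. S \<subseteq> V \<and> card S = s \<and> A \<subseteq> S} = (card V - card A) choose (s - card A)"
proof -
  have fA: "finite A" using assms finite_subset by auto
  have "bij_betw (\<lambda>S. S - A) {S. S \<subseteq> V \<and> card S = s \<and> A \<subseteq> S} {X. X \<subseteq> V - A \<and> card X = s - card A}"
  proof (rule bij_betw_byWitness[where f'="\<lambda>X. X \<union> A"])
    show "(\<lambda>S. S - A) ` {S. S \<subseteq> V \<and> card S = s \<and> A \<subseteq> S} \<subseteq> {X. X \<subseteq> V - A \<and> card X = s - card A}"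
      using fA by (auto simp: card_Diff_subset)
    show "(\<lambda>X. X \<union> A) ` {X. X \<subseteq> V - A \<and> card X = s - card A} \<subseteq> {S. S \<subseteq> V \<and> card S = s \<and> A \<subseteq> S}"
    proof (rule image_subsetI)
      fix X assume X: "X \<in> {X. X \<subseteq> V - A \<and> card X = s - card A}"
      then have "finite X" "X \<inter> A = {}" using assms(1) finite_subset[of X V] by auto
      then have "card (X \<union> A) = s" using X fA assms by (simp add: card_Un_disjoint)
      then show "X \<union> A \<in> {S. S \<subseteq> V \<and> card S = s \<and> A \<subseteq> S}" using X assms by auto
    qed
  qed auto
  then have "card {S. S \<subseteq> V \<and> card S = s \<and> A \<subseteq> S} = card {X. X \<subseteq> V - A \<and> card X = s - card A}"
    by (rule bij_betw_same_card)
  also have "\<dots> = card (V - A) choose (s - card A)" using assms by (intro n_subsets) auto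
  finally show ?thesis using assms fA by (simp add: card_Diff_subset)
qed

lemma choose_containing_Suc:
  assumes "a < s" "s \<le> n"
  shows "real (n - a) * real ((n - Suc a) choose (s - Suc a)) = real (s - a) * real ((n - a) choose (s - a))"
proof -
  obtain m j where "n - a = Suc m" "s - a = Suc j"
    using assms by (metis Suc_diff_Suc less_le_trans)
  moreover from this have "n - Suc a = m" "s - Suc a = j" by auto
  ultimately show ?thesis
    using Suc_times_binomial[of j m] by (metis of_nat_mult)
qed

text \<open>In a uniformly random s-set, given that a points are already inside, a further point is
  inside with probability (s - a) / (n - a) \<le> s / n. Dividing by the count for r points removes
  the factor shared with the edges.\<close>

lemma choose_containing_le:
  assumes "r + d \<le> s" "s \<le> n"
  shows "real ((n - (r + d)) choose (s - (r + d))) \<le> (real s / n) ^ d * ((n - r) choose (s - r))"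
  using assms
proof (induction d)
  case (Suc d)
  define a where "a = r + d"
  have a: "a < s" using Suc by (simp add: a_def)
  have n: "0 < real n - a" "real (n - a) = real n - a" "real (s - a) = real s - a" using a Suc by auto
  have "real a * real s \<le> real a * real n" using Suc.prems(2) by (intro mult_left_mono) auto
  then have frac: "(real s - a) / (real n - a) \<le> real s / n"
    using a Suc.prems(2) by (simp add: field_simps)
  have "real ((n - Suc a) choose (s - Suc a)) = (real s - a) / (real n - a) * ((n - a) choose (s - a))"
    using choose_containing_Suc[OF a Suc.prems(2)] n by (simp add: field_simps)
  also have "\<dots> \<le> real s / n * ((n - a) choose (s - a))"
    using frac by (intro mult_right_mono) auto
  also have "\<dots> \<le> real s / n * ((real s / n) ^ d * ((n - r) choose (s - r)))"
    using Suc by (intro mult_left_mono) (auto simp: a_def)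
  finally show ?case by (simp add: a_def mult.assoc)
qed simp

text \<open>The same conditional probabilities from below: for d < r \<le> s one has (s - d) / (n -
  d) \<ge> (s - d) / n \<ge> s / (r n). The loss of r per point is the source of the constant r^r
  later on.\<close>

lemma choose_containing_ge:
  assumes "r \<le> s" "s \<le> n" "d \<le> r"
  shows "(real s / (r * n)) ^ d * (n choose s) \<le> real ((n - d) choose (s - d))"
  using assms(3)
proof (induction d)
  case (Suc d)
  have a: "d < s" using Suc assms by simp
  have n: "0 < real n - d" "real (n - d) = real n - d" "real (s - d) = real s - d" using a assms by auto
  have "real s / r \<le> real s - d"
  proof -
    have "0 \<le> (real s - r) * (real r - 1) + real r * (real r - 1 - d)"
      using Suc assms by (intro add_nonneg_nonneg mult_nonneg_nonneg) auto
    then show ?thesis using Suc by (simp add: field_simps)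
  qed
  then have "real s / r / n \<le> (real s - d) / n" by (intro divide_right_mono) auto
  also have "\<dots> \<le> (real s - d) / (real n - d)"
    using n a by (intro divide_left_mono) auto
  finally have le: "real s / (r * n) \<le> (real s - d) / (real n - d)" by simp
  have "(real s / (r * n)) ^ Suc d * (n choose s) = real s / (r * n) * ((real s / (r * n)) ^ d * (n choose s))"
    by simp
  also have "\<dots> \<le> (real s - d) / (real n - d) * real ((n - d) choose (s - d))"
    using Suc le a n by (intro mult_mono) auto
  also have "\<dots> = real ((n - Suc d) choose (s - Suc d))"
    using choose_containing_Suc[OF a assms(2)] n by (simp add: field_simps)
  finally show ?case .
qed simp

lemma sum_card_filter_swap:
  assumes "finite X" "finite Y"
  shows "(\<Sum>x\<in>X. real (card {y \<in> Y. R x y})) = (\<Sum>y\<in>Y. real (card {x \<in> X. R x y}))"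
proof -
  have "(\<Sum>x\<in>X. real (card {y \<in> Y. R x y})) = (\<Sum>x\<in>X. \<Sum>y\<in>Y. if R x y then 1 else 0)"
    using assms by (simp add: sum.If_cases Int_def)
  also have "\<dots> = (\<Sum>y\<in>Y. \<Sum>x\<in>X. if R x y then 1 else 0)" by (rule sum.swap)
  also have "\<dots> = (\<Sum>y\<in>Y. real (card {x \<in> X. R x y}))"
    using assms by (simp add: sum.If_cases Int_def)
  finally show ?thesis .
qed

text \<open>Averaging over all s-sets: an edge lies inside with probability P = C(n - r, s - r) /
  C(n, s), and \<open>U T\<close> with probability at most P (s/n)^(|U T| - r). By
  \<open>few\<close> the expected difference is at least P |E| / 2, so some s-set attains
  it.\<close>

lemma dense_subset_avoiding:
  assumes V: "finite V" "card V = n" and rs: "r \<le> s" "s \<le> n"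
    and E: "\<And>e. e \<in> E \<Longrightarrow> e \<subseteq> V \<and> card e = r"
    and X: "finite X" "\<And>T. T \<in> X \<Longrightarrow> U T \<subseteq> V \<and> r \<le> card (U T)"
    and few: "(\<Sum>T\<in>X. (real s / n) ^ (card (U T) - r)) \<le> card E / 2"
  obtains S where "S \<subseteq> V" "card S = s"
    "((n - r) choose (s - r)) / (n choose s) * (card E / 2) \<le> real (card {e \<in> E. e \<subseteq> S}) - card {T \<in> X. U T \<subseteq> S}"
proof -
  define \<S> where "\<S> = {S. S \<subseteq> V \<and> card S = s}"
  define c where "c = real ((n - r) choose (s - r))"
  have fS: "finite \<S>" and fE: "finite E"
    using V(1) E by (auto simp: \<S>_def intro: finite_subset[of _ "Pow V"])
  have cS: "card \<S> = n choose s" unfolding \<S>_def using n_subsets[OF V(1)] V by simp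
  have pos: "0 < real (n choose s)" using rs by simp
  have c0: "0 \<le> c" by (simp add: c_def)
  have eq: "{S \<in> \<S>. A \<subseteq> S} = {S. S \<subseteq> V \<and> card S = s \<and> A \<subseteq> S}" for A by (auto simp: \<S>_def)
  have "(\<Sum>S\<in>\<S>. real (card {e \<in> E. e \<subseteq> S})) = (\<Sum>e\<in>E. real (card {S \<in> \<S>. e \<subseteq> S}))"
    by (rule sum_card_filter_swap[OF fS fE])
  also have "\<dots> = (\<Sum>e\<in>E. c)"
    unfolding c_def using E V rs by (intro sum.cong refl) (simp add: eq card_supersets_of_card)
  finally have 1: "(\<Sum>S\<in>\<S>. real (card {e \<in> E. e \<subseteq> S})) = card E * c" by simp
  have "(\<Sum>S\<in>\<S>. real (card {T \<in> X. U T \<subseteq> S})) = (\<Sum>T\<in>X. real (card {S \<in> \<S>. U T \<subseteq> S}))"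
    by (rule sum_card_filter_swap[OF fS X(1)])
  also have "\<dots> \<le> (\<Sum>T\<in>X. (real s / n) ^ (card (U T) - r) * c)"
  proof (rule sum_mono)
    fix T assume T: "T \<in> X"
    show "real (card {S \<in> \<S>. U T \<subseteq> S}) \<le> (real s / n) ^ (card (U T) - r) * c"
    proof (cases "card (U T) \<le> s")
      case True
      then show ?thesis
        using choose_containing_le[of r "card (U T) - r" s n] X(2)[OF T] rs V
        by (simp add: eq card_supersets_of_card c_def)
    next
      \<comment> \<open>More than s points never fit into an s-set; the truncated subtraction in the
        binomial formula would not see this.\<close>
      case False
      have "\<not> U T \<subseteq> S" if "S \<in> \<S>" for S
        using False that card_mono[of S "U T"] finite_subset[OF _ V(1), of S] by (auto simp: \<S>_def)
      then have empty: "{S \<in> \<S>. U T \<subseteq> S} = {}" by auto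
      show ?thesis unfolding empty using c0 by simp
    qed
  qed
  also have "\<dots> \<le> card E / 2 * c"
    unfolding sum_distrib_right[symmetric] using few c0 by (rule mult_right_mono)
  finally have 2: "card E / 2 * c
      \<le> (\<Sum>S\<in>\<S>. real (card {e \<in> E. e \<subseteq> S}) - card {T \<in> X. U T \<subseteq> S})"
    using 1 by (simp add: sum_subtractf algebra_simps)
  have "\<exists>S\<in>\<S>. c / (n choose s) * (card E / 2) \<le> real (card {e \<in> E. e \<subseteq> S}) - card {T \<in> X. U T \<subseteq> S}"
  proof (rule ccontr)
    assume "\<not> ?thesis"
    moreover have "\<S> \<noteq> {}" using cS pos by auto
    ultimately have "(\<Sum>S\<in>\<S>. real (card {e \<in> E. e \<subseteq> S}) - card {T \<in> X. U T \<subseteq> S})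
        < (\<Sum>S\<in>\<S>. c / (n choose s) * (card E / 2))"
      using fS by (intro sum_strict_mono) auto
    also have "\<dots> = card E / 2 * c" using pos by (simp add: cS)
    finally show False using 2 by simp
  qed
  then show ?thesis using that by (auto simp: \<S>_def c_def)
qed

text \<open>Deleting one edge of each member of \<open>X\<close> spanned by the sample leaves more
  than ex(s, H) edges. If the resulting copy contained some T in \<open>X\<close>, then T would be
  spanned by the sample, and its deleted edge would belong to the copy.\<close>

lemma copy_avoiding:
  fixes G :: "nat hypergraph"
  assumes G: "uniform_hypergraph r G" "card (verts G) = n" and rs: "r \<le> s" "s \<le> n"
    and X: "finite X" "\<And>T. T \<in> X \<Longrightarrow> T \<subseteq> edges G \<and> T \<noteq> {}"
    and few: "(\<Sum>T\<in>X. (real s / n) ^ (card (\<Union>T) - r)) \<le> card (edges G) / 2"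
    and dense: "ex_num r s H < ((n - r) choose (s - r)) / (n choose s) * (card (edges G) / 2)"
  obtains A where "A \<in> copies H G" "\<And>T. T \<in> X \<Longrightarrow> \<not> T \<subseteq> A"
proof -
  have V: "finite (verts G)" and E: "\<And>e. e \<in> edges G \<Longrightarrow> e \<subseteq> verts G \<and> card e = r"
    using G by (auto simp: uniform_hypergraph_def)
  have fE: "finite (edges G)" using G(1) by (rule uniform_finite_edges)
  have "\<Union>T \<subseteq> verts G \<and> r \<le> card (\<Union>T)" if "T \<in> X" for T
  proof -
    obtain e where "e \<in> T" using X(2)[OF \<open>T \<in> X\<close>] by auto
    have "\<Union>T \<subseteq> verts G" using X(2)[OF that] E by blast
    moreover from this have "finite (\<Union>T)" using V finite_subset by blast
    then have "card e \<le> card (\<Union>T)" using \<open>e \<in> T\<close> by (intro card_mono) auto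
    ultimately show ?thesis using E X(2)[OF that] \<open>e \<in> T\<close> by auto
  qed
  from dense_subset_avoiding[where U=Union, OF V G(2) rs E X(1) this few]
  obtain S where S: "S \<subseteq> verts G" "card S = s" and
    diff: "((n - r) choose (s - r)) / (n choose s) * (card (edges G) / 2)
      \<le> real (card {e \<in> edges G. e \<subseteq> S}) - card {T \<in> X. \<Union>T \<subseteq> S}"
    by auto
  define Y where "Y = {T \<in> X. \<Union>T \<subseteq> S}"
  define rem where "rem = (\<lambda>T. SOME e. e \<in> T) ` Y"
  have rem_in: "(SOME e. e \<in> T) \<in> T" if "T \<in> X" for T
    using X(2)[OF that] by (auto intro: someI_ex)
  define G' where "G' = Hypergraph S ({e \<in> edges G. e \<subseteq> S} - rem)"
  have "uniform_hypergraph r G'"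
    unfolding uniform_hypergraph_def G'_def using S V E finite_subset by auto
  moreover have "card (verts G') = s" by (simp add: G'_def S)
  moreover have "ex_num r s H < card (edges G')"
  proof -
    have fY: "finite Y" using X(1) by (simp add: Y_def)
    have "card {e \<in> edges G. e \<subseteq> S} \<le> card (edges G') + card rem"
    proof -
      have "{e \<in> edges G. e \<subseteq> S} \<subseteq> edges G' \<union> rem" by (auto simp: G'_def)
      then have "card {e \<in> edges G. e \<subseteq> S} \<le> card (edges G' \<union> rem)"
        using fE fY by (intro card_mono) (auto simp: G'_def rem_def)
      also have "\<dots> \<le> card (edges G') + card rem" by (rule card_Un_le)
      finally show ?thesis .
    qed
    also have "card rem \<le> card Y" unfolding rem_def using fY by (rule card_image_le)
    finally show ?thesis using diff dense unfolding Y_def by linarith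
  qed
  ultimately have "\<not> hfree H G'" using card_edges_le_ex_num[of r G' H] by auto
  then obtain A where A: "A \<in> copies H G'" by (auto simp: hfree_def)
  then have AG: "A \<in> copies H G" using copies_mono[of G' G H] S by (auto simp: G'_def)
  have "\<not> T \<subseteq> A" if T: "T \<in> X" for T
  proof
    assume TA: "T \<subseteq> A"
    then have TG': "T \<subseteq> edges G'" using copies_subset[OF A] by auto
    then have "\<Union>T \<subseteq> S" by (auto simp: G'_def)
    then have "(SOME e. e \<in> T) \<in> rem" using T by (auto simp: rem_def Y_def)
    then show False using rem_in[OF T] TG' by (auto simp: G'_def)
  qed
  then show ?thesis using that AG by auto
qed

section \<open>Maximal families with bounded degrees\<close>

lemma sum_card_supersets_le:
  assumes "finite h" "finite X" "\<And>A. A \<in> h \<Longrightarrow> finite A \<and> card A = k"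
  shows "(\<Sum>T\<in>X. real (card {A \<in> h. T \<subseteq> A})) \<le> 2 ^ k * real (card h)"
proof -
  have "(\<Sum>T\<in>X. real (card {A \<in> h. T \<subseteq> A})) = (\<Sum>A\<in>h. real (card {T \<in> X. T \<subseteq> A}))"
    by (rule sum_card_filter_swap[OF assms(2,1)])
  also have "\<dots> \<le> (\<Sum>A\<in>h. 2 ^ k)"
  proof (rule sum_mono)
    fix A assume A: "A \<in> h"
    have "card {T \<in> X. T \<subseteq> A} \<le> card (Pow A)" using assms A by (intro card_mono) auto
    also have "\<dots> = 2 ^ k" using assms A by (simp add: card_Pow)
    finally have "real (card {T \<in> X. T \<subseteq> A}) \<le> real (2 ^ k)" by (rule of_nat_mono)
    then show "real (card {T \<in> X. T \<subseteq> A}) \<le> 2 ^ k" by simp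
  qed
  finally show ?thesis by (simp add: mult.commute)
qed

text \<open>For a saturated T the density condition gives (s/n)^(|\<Union>T| - r) \<le> D^(k - |T|)
  / D^(k - 1), and D^(k - |T|) is at most twice the degree of T. Summing degrees over all T costs
  2^k per member of the family, so a small family has a small weighted number of saturated sets, as
  sampling requires.\<close>

lemma balanced_family_of_copies:
  fixes G :: "nat hypergraph" and D :: real
  assumes H: "uniform_hypergraph r H" and k: "k = card (edges H)" "1 \<le> k"
    and G: "uniform_hypergraph r G" "card (verts G) = n"
    and rs: "r \<le> s" "s \<le> n" and D: "1 \<le> D"
    and spread: "\<And>F. F \<subseteq> edges H \<Longrightarrow> F \<noteq> {} \<Longrightarrow> (real s / n) ^ (card (\<Union>F) - r) \<le> (1 / D) ^ (card F - 1)"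
    and dense: "ex_num r s H < ((n - r) choose (s - r)) / (n choose s) * (card (edges G) / 2)"
  obtains h where "h \<subseteq> copies H G" "card (edges G) * D ^ (k - 1) / 2 ^ (2 * k + 3) \<le> card h"
    "\<And>T. T \<subseteq> edges G \<Longrightarrow> T \<noteq> {} \<Longrightarrow> card T \<le> k \<Longrightarrow> card {A \<in> h. T \<subseteq> A} \<le> D ^ (k - card T)"
proof -
  define good where "good h \<longleftrightarrow> h \<subseteq> copies H G \<and>
    (\<forall>T. T \<subseteq> edges G \<longrightarrow> T \<noteq> {} \<longrightarrow> card T \<le> k \<longrightarrow> card {A \<in> h. T \<subseteq> A} \<le> D ^ (k - card T))" for h
  have fC: "finite (copies H G)" using G(1) by (rule finite_copies)
  have fE: "finite (edges G)" using G(1) by (rule uniform_finite_edges)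
  have "good {}" using D by (simp add: good_def)
  moreover have fgood: "finite {h. good h}"
    by (rule finite_subset[of _ "Pow (copies H G)"]) (use fC in \<open>auto simp: good_def\<close>)
  ultimately have "\<exists>h\<in>{h. good h}. \<forall>h'\<in>{h. good h}. h \<subseteq> h' \<longrightarrow> h = h'"
    by (intro finite_has_maximal) auto
  then obtain h where h: "good h" and max: "\<And>h'. good h' \<Longrightarrow> h \<subseteq> h' \<Longrightarrow> h = h'" by blast
  have hC: "h \<subseteq> copies H G" using h by (simp add: good_def)
  have fh: "finite h" using hC fC finite_subset by auto
  have hA: "finite A \<and> card A = k" if "A \<in> h" for A
  proof -
    have "A \<in> copies H G" using hC that by auto
    then show ?thesis using card_copy[OF H] finite_subset[OF copies_subset fE] k(1) by auto
  qed
  have "card (edges G) * D ^ (k - 1) / 2 ^ (2 * k + 3) \<le> card h"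
  proof (rule ccontr)
    assume small: "\<not> ?thesis"
    \<comment> \<open>The \<open>+ 1\<close> says that one more copy through T would exceed the cap.
      As the cap is at least 1, such a T already has degree at least 1: it lies in a member of
      \<open>h\<close> and can be pulled back to \<open>H\<close>, and the cap is below degree + 1,
      at most twice the degree.\<close>
    define X where "X = {T. T \<subseteq> edges G \<and> T \<noteq> {} \<and> card T \<le> k \<and> D ^ (k - card T) < card {A \<in> h. T \<subseteq> A} + 1}"
    have fX: "finite X" by (rule finite_subset[of _ "Pow (edges G)"]) (use fE in \<open>auto simp: X_def\<close>)
    have deg_term: "(real s / n) ^ (card (\<Union>T) - r) \<le> 2 / D ^ (k - 1) * card {A \<in> h. T \<subseteq> A}"
      if T: "T \<in> X" for T
    proof -
      define dg where "dg = card {A \<in> h. T \<subseteq> A}"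
      define x where "x = D ^ (k - card T)"
      have x: "1 \<le> x" "x < dg + 1" using T D by (auto simp: X_def x_def dg_def one_le_power)
      then have dg: "1 \<le> dg" by linarith
      then have x2: "x \<le> 2 * dg" using x by linarith
      have "{A \<in> h. T \<subseteq> A} \<noteq> {}"
        using dg unfolding dg_def by (metis card.empty not_one_le_zero)
      then obtain A where A: "A \<in> h" "T \<subseteq> A" by blast
      have AC: "A \<in> copies H G" using A(1) hC by auto
      obtain F where F: "F \<subseteq> edges H" "card F = card T" "card (\<Union>F) = card (\<Union>T)" "F = {} \<longleftrightarrow> T = {}"
        "T = A \<Longrightarrow> F = edges H"
        using subset_copy_preimage[OF H AC A(2)] by metis
      have cT: "1 \<le> card T" "card T \<le> k"
        using T finite_subset[OF _ fE, of T] by (auto simp: X_def Suc_le_eq card_gt_0_iff)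
      have "(real s / n) ^ (card (\<Union>T) - r) \<le> (1 / D) ^ (card T - 1)"
        using spread[of F] F T by (auto simp: X_def)
      also have "\<dots> = x / D ^ (k - 1)"
      proof -
        have "D ^ (k - 1) = x * D ^ (card T - 1)"
          unfolding x_def power_add[symmetric] using cT by simp
        then show ?thesis using D x by (simp add: power_divide)
      qed
      also have "\<dots> \<le> 2 * dg / D ^ (k - 1)"
        using x2 D by (intro divide_right_mono) auto
      finally show ?thesis by (simp add: dg_def)
    qed
    have "(\<Sum>T\<in>X. (real s / n) ^ (card (\<Union>T) - r)) \<le> (\<Sum>T\<in>X. 2 / D ^ (k - 1) * card {A \<in> h. T \<subseteq> A})"
      by (rule sum_mono) (rule deg_term)
    also have "\<dots> \<le> 2 / D ^ (k - 1) * (2 ^ k * real (card h))"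
      unfolding sum_distrib_left[symmetric] using D
      by (intro mult_left_mono sum_card_supersets_le fh fX hA) auto
    also have "\<dots> \<le> 2 / D ^ (k - 1) * (2 ^ k * (card (edges G) * D ^ (k - 1) / 2 ^ (2 * k + 3)))"
      using small D by (intro mult_left_mono) auto
    also have "\<dots> = card (edges G) / (2 ^ k * 4)"
    proof -
      have "(2::real) ^ (2 * k + 3) = 2 ^ k * 2 ^ k * 8" unfolding mult_2 power_add by simp
      then show ?thesis using D by simp
    qed
    also have "\<dots> \<le> card (edges G) / 2"
    proof (rule divide_left_mono)
      have "(1::real) \<le> 2 ^ k" by (rule one_le_power) simp
      then show "2 \<le> (2::real) ^ k * 4" by linarith
    qed auto
    finally have few: "(\<Sum>T\<in>X. (real s / n) ^ (card (\<Union>T) - r)) \<le> card (edges G) / 2" .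
    have "\<And>T. T \<in> X \<Longrightarrow> T \<subseteq> edges G \<and> T \<noteq> {}" by (auto simp: X_def)
    from copy_avoiding[OF G rs fX this few dense]
    obtain A where A: "A \<in> copies H G" and avoid: "\<And>T. T \<in> X \<Longrightarrow> \<not> T \<subseteq> A" by blast
    have cA: "card A = k" using card_copy[OF H A] k by simp
    have AE: "A \<subseteq> edges G" using A by (rule copies_subset)
    \<comment> \<open>For T = A the cap is D^0 = 1, so a copy already in \<open>h\<close> is itself
      saturated and has been avoided.\<close>
    have "A \<notin> h"
    proof
      assume "A \<in> h"
      then have "0 < card {B \<in> h. A \<subseteq> B}" using fh by (auto simp: card_gt_0_iff)
      then have "A \<in> X" using cA AE k(2) by (auto simp: X_def)
      then show False using avoid by blast
    qed
    have "good (insert A h)"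
      unfolding good_def
    proof (intro conjI allI impI)
      show "insert A h \<subseteq> copies H G" using A hC by auto
      fix T assume T: "T \<subseteq> edges G" "T \<noteq> {}" "card T \<le> k"
      show "card {B \<in> insert A h. T \<subseteq> B} \<le> D ^ (k - card T)"
      proof (cases "T \<subseteq> A")
        case True
        then have "T \<notin> X" using avoid by auto
        moreover have "{B \<in> insert A h. T \<subseteq> B} = insert A {B \<in> h. T \<subseteq> B}" using True by auto
        ultimately show ?thesis using T fh \<open>A \<notin> h\<close> by (simp add: X_def)
      next
        case False
        then have "{B \<in> insert A h. T \<subseteq> B} = {B \<in> h. T \<subseteq> B}" by auto
        then show ?thesis using h T by (simp add: good_def)
      qed
    qed
    then show False using max[of "insert A h"] \<open>A \<notin> h\<close> by auto
  qed
  then show ?thesis using that h unfolding good_def by blast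
qed

text \<open>Mirrors the required conclusion with \<open>b\<close> in place of b_t. Nonemptiness is
  demanded separately because for l \<le> e(G) both sides of the degree bound vanish on an empty
  family.\<close>

definition has_balanced_copies :: "'a hypergraph \<Rightarrow> nat hypergraph \<Rightarrow> real \<Rightarrow> bool" where
  "has_balanced_copies H G b \<longleftrightarrow> (\<exists>HG :: nat set hypergraph.
      verts HG = edges G \<and> edges HG \<subseteq> copies H G \<and> edges HG \<noteq> {} \<and>
      uniform_hypergraph (card (edges H)) HG \<and>
      (\<forall>l\<in>{1..card (edges H)}.
         real (max_degree l HG)
           \<le> 2 ^ (2 * card (edges H) + 3)
              * (b / real (card (edges G))) ^ (l - 1)
              * (real (card (edges HG)) / real (card (edges G)))))"

text \<open>With D = e(G) / b the cap is D^(k - l) = D^(k - 1) (b / e(G))^(l - 1), and the lower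
  bound on the size of the family replaces D^(k - 1) by 2^(2 k + 3) |h| / e(G).\<close>

lemma balanced_hypergraph_of_copies:
  fixes G :: "nat hypergraph" and b :: real
  assumes H: "uniform_hypergraph r H" "1 \<le> card (edges H)"
    and G: "uniform_hypergraph r G" "card (verts G) = n"
    and rs: "r \<le> s" "s \<le> n" and b: "0 < b" "b \<le> card (edges G)"
    and spread: "\<And>F. F \<subseteq> edges H \<Longrightarrow> F \<noteq> {} \<Longrightarrow> (real s / n) ^ (card (\<Union>F) - r) \<le> (b / card (edges G)) ^ (card F - 1)"
    and dense: "ex_num r s H < ((n - r) choose (s - r)) / (n choose s) * (card (edges G) / 2)"
  shows "has_balanced_copies H G b"
proof -
  define k where "k = card (edges H)"
  define e where "e = real (card (edges G))"
  define D where "D = e / b"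
  have D: "1 \<le> D" "1 / D = b / e" using b by (auto simp: D_def e_def)
  have e: "0 < e" using b by (simp add: e_def)
  have k: "1 \<le> k" using H by (simp add: k_def)
  have fE: "finite (edges G)" using G(1) by (rule uniform_finite_edges)
  have "(real s / n) ^ (card (\<Union>F) - r) \<le> (1 / D) ^ (card F - 1)" if "F \<subseteq> edges H" "F \<noteq> {}" for F
    using spread[OF that] D by (simp add: e_def)
  from balanced_family_of_copies[OF H(1) k_def k G rs D(1) this dense]
  obtain h where h: "h \<subseteq> copies H G" and big: "e * D ^ (k - 1) / 2 ^ (2 * k + 3) \<le> card h" and
    deg: "\<And>T. T \<subseteq> edges G \<Longrightarrow> T \<noteq> {} \<Longrightarrow> card T \<le> k \<Longrightarrow> card {A \<in> h. T \<subseteq> A} \<le> D ^ (k - card T)"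
    unfolding e_def by blast
  have "0 < e * D ^ (k - 1) / 2 ^ (2 * k + 3)" using e D by simp
  then have "0 < card h" using big by linarith
  then have hne: "h \<noteq> {}" by auto
  then obtain A where A: "A \<in> h" by auto
  have hA: "A \<subseteq> edges G" "card A = k" if "A \<in> h" for A
    using h that copies_subset[of A H G] card_copy[OF H(1), of A G] by (auto simp: k_def)
  define HG where "HG = Hypergraph (edges G) h"
  have "real (max_degree l HG) \<le> 2 ^ (2 * k + 3) * (b / e) ^ (l - 1) * (card h / e)" if l: "l \<in> {1..k}" for l
  proof -
    define \<D> where "\<D> = {card {e \<in> edges HG. T \<subseteq> e} | T. T \<subseteq> verts HG \<and> card T = l}"
    have "\<D> = (\<lambda>T. card {e \<in> edges HG. T \<subseteq> e}) ` {T. T \<subseteq> verts HG \<and> card T = l}"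
      by (auto simp: \<D>_def)
    then have fD: "finite \<D>" using fE by (simp add: HG_def)
    \<comment> \<open>An l-subset of any copy shows that the maximum defining
      \<open>max_degree\<close> ranges over a nonempty set, hence is attained.\<close>
    obtain T where T: "T \<subseteq> A" "card T = l"
      using obtain_subset_with_card_n[of l A] hA(2)[OF A] l by auto
    then have "card {e \<in> edges HG. T \<subseteq> e} \<in> \<D>" using hA(1)[OF A] by (auto simp: \<D>_def HG_def)
    then have "\<D> \<noteq> {}" by auto
    then have "Max \<D> \<in> \<D>" using fD by simp
    then obtain T where T: "T \<subseteq> edges G" "card T = l" "max_degree l HG = card {A \<in> h. T \<subseteq> A}"
      by (auto simp: \<D>_def max_degree_def HG_def)
    moreover from this have "T \<noteq> {}" using l by auto
    ultimately have "real (max_degree l HG) \<le> D ^ (k - l)"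
      using deg[of T] l by auto
    also have "\<dots> = D ^ (k - 1) * (1 / D) ^ (l - 1)"
    proof -
      have "D ^ (k - 1) = D ^ (k - l) * D ^ (l - 1)"
        unfolding power_add[symmetric] using l by simp
      then show ?thesis using D(1) by (simp add: power_divide)
    qed
    also have "\<dots> \<le> (2 ^ (2 * k + 3) * card h / e) * (1 / D) ^ (l - 1)"
      using big e D(1) by (intro mult_right_mono) (auto simp: field_simps)
    finally show ?thesis using D(2) by (simp add: mult_ac)
  qed
  then show ?thesis
    unfolding has_balanced_copies_def using h hne fE hA
    by (intro exI[of _ HG]) (auto simp: HG_def uniform_hypergraph_def k_def[symmetric] e_def)
qed

section \<open>Choice of the sampling density\<close>

lemma card_Union_gt:
  assumes F: "\<And>e. e \<in> F \<Longrightarrow> finite e \<and> card e = r" and "finite (\<Union>F)" and "2 \<le> card F"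
  shows "r < card (\<Union>F)"
proof -
  have "\<not> card F \<le> Suc 0" "finite F" using assms(3) card_ge_0_finite[of F] by auto
  then obtain e1 e2 where e: "e1 \<in> F" "e2 \<in> F" "e1 \<noteq> e2"
    by (auto simp: card_le_Suc0_iff_eq)
  have "e1 \<subset> e1 \<union> e2"
    using e F card_subset_eq[of e1 e2] by (metis Un_upper1 Un_upper2 card_subset_eq psubsetI sup.orderE)
  then have "card e1 < card (e1 \<union> e2)" using F e by (intro psubset_card_mono) auto
  also have "\<dots> \<le> card (\<Union>F)" using assms(2) e by (intro card_mono) auto
  finally show ?thesis using F e by auto
qed

text \<open>The competitor in the maximum is F on the vertices it covers, without isolated ones. Two
  distinct r-sets cover more than r vertices, so the denominator is positive.\<close>

lemma r_density_ge:
  assumes H: "uniform_hypergraph r H" and F: "F \<subseteq> edges H" "2 \<le> card F"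
  shows "r < card (\<Union>F)"
    and "(real (card F) - 1) / (real (card (\<Union>F)) - real r) \<le> r_density r H"
proof -
  have V: "finite (verts H)" and E: "\<And>e. e \<in> edges H \<Longrightarrow> e \<subseteq> verts H \<and> card e = r"
    using H by (auto simp: uniform_hypergraph_def)
  have sub: "\<Union>F \<subseteq> verts H" using E F(1) by blast
  have "finite e \<and> card e = r" if "e \<in> F" for e
    using E[of e] F(1) that finite_subset[OF _ V] by auto
  then show gt: "r < card (\<Union>F)"
    using finite_subset[OF sub V] F(2) by (rule card_Union_gt)
  define X where "X = {(real (card (edges F)) - 1) / (real (card (verts F)) - real r) | F.
     uniform_hypergraph r F \<and> subhypergraph F H \<and> card (verts F) > r}"
  have "X \<subseteq> (\<lambda>(A, B). (real (card B) - 1) / (real (card A) - real r)) ` (Pow (verts H) \<times> Pow (edges H))"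
  proof
    fix x assume "x \<in> X"
    then obtain F where F: "x = (real (card (edges F)) - 1) / (real (card (verts F)) - real r)"
      "subhypergraph F H" by (auto simp: X_def)
    then show "x \<in> (\<lambda>(A, B). (real (card B) - 1) / (real (card A) - real r)) ` (Pow (verts H) \<times> Pow (edges H))"
      by (intro image_eqI[of _ _ "(verts F, edges F)"]) (auto simp: subhypergraph_def)
  qed
  then have "finite X"
    by (rule finite_subset) (use V uniform_finite_edges[OF H] in auto)
  moreover have "(real (card F) - 1) / (real (card (\<Union>F)) - real r) \<in> X"
  proof -
    have "uniform_hypergraph r (Hypergraph (\<Union>F) F)" "subhypergraph (Hypergraph (\<Union>F) F) H"
      using F E sub V finite_subset[OF sub V] by (auto simp: uniform_hypergraph_def subhypergraph_def)
    then show ?thesis using gt unfolding X_def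
      by (intro CollectI exI[of _ "Hypergraph (\<Union>F) F"]) auto
  qed
  ultimately show "(real (card F) - 1) / (real (card (\<Union>F)) - real r) \<le> r_density r H"
    unfolding r_density_def X_def[symmetric] by (rule Max_ge)
qed

lemma r_density_pos:
  assumes H: "uniform_hypergraph r H" "2 \<le> card (edges H)"
  shows "0 < r_density r H"
proof -
  have "0 < (real (card (edges H)) - 1) / (real (card (\<Union>(edges H))) - real r)"
    using r_density_ge(1)[OF H(1) order_refl H(2)] H(2) by simp
  then show ?thesis using r_density_ge(2)[OF H(1) order_refl H(2)] by linarith
qed

text \<open>A single edge contains no copy of a hypergraph with two edges. Together with the
  hypothesis at s = r this ties M to n.\<close>

lemma ex_num_pos:
  assumes "2 \<le> card (edges H)" "uniform_hypergraph r H"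
  shows "1 \<le> ex_num r r H"
proof -
  define G where "G = Hypergraph {1..r} {{1..r}}"
  have "uniform_hypergraph r G" by (simp add: G_def uniform_hypergraph_def)
  moreover have "hfree H G"
    unfolding hfree_def
  proof (rule equals0I)
    fix A assume A: "A \<in> copies H G"
    then have "card A \<le> card {{1..r}}"
      using copies_subset[OF A] by (intro card_mono) (auto simp: G_def)
    then show False using card_copy[OF assms(2) A] assms(1) by simp
  qed
  ultimately have "card (edges G) \<le> ex_num r (card (verts G)) H" by (rule card_edges_le_ex_num)
  then show ?thesis by (simp add: G_def)
qed

lemma polynomial_less_power:
  fixes \<gamma> \<theta> c :: real
  assumes "1 < \<gamma>" "\<theta> < 1"
  shows "\<exists>t0. \<forall>t::nat\<ge>t0. c * (real t + 1) ^ 3 < (\<gamma> ^ t) powr (1 - \<theta>)"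
proof -
  define a where "a = ln \<gamma> * (1 - \<theta>)"
  have a: "0 < a" using assms by (simp add: a_def)
  have "eventually (\<lambda>t::nat. c * (real t + 1) ^ 3 < exp (a * real t)) at_top"
    using a by real_asymp
  then obtain t0 where t0: "\<forall>t\<ge>t0. c * (real t + 1) ^ 3 < exp (a * real t)"
    by (auto simp: eventually_at_top_linorder)
  have "exp (a * real t) = (\<gamma> ^ t) powr (1 - \<theta>)" for t
    using assms by (simp add: powr_def a_def ln_realpow)
  then show ?thesis using t0 by auto
qed

text \<open>Here \<open>T\<close> stands for \<open>(t + 1) ^ 3\<close>. Up to constants, the hypothesis \<open>big\<close> says that
  \<open>p powr (r - \<alpha>) * e(G)\<close> exceeds \<open>M\<close> for the sampling density \<open>p = (M / (e(G) * T)) powr m\<close>; it also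
  forces \<open>p * n \<ge> r\<close>.\<close>

lemma has_balanced_copies_numeric:
  fixes G :: "nat hypergraph" and M \<alpha> T :: real
  assumes H: "uniform_hypergraph r H" "2 \<le> card (edges H)"
    and \<alpha>: "\<alpha> < r" and m: "m = r_density r H"
    and G: "uniform_hypergraph r G" "card (verts G) = n"
    and ex: "\<And>s. s \<in> {1..n} \<Longrightarrow> real (ex_num r s H) \<le> M * (real s / real n) powr \<alpha>"
    and M: "0 < M" and e: "e = real (card (edges G))" and e0: "0 < e"
    and T: "1 \<le> T" "M \<le> e"
    and big: "2 powr (r - \<alpha>) * 2 * real r ^ r * (e * T / M) powr (m * (r - \<alpha>)) < e / M"
  shows "has_balanced_copies H G (M / T)"
proof -
  define D where "D = e * T / M"
  define \<theta> where "\<theta> = m * (r - \<alpha>)"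
  define y where "y = e / M"
  define p where "p = D powr (- m)"
  have m0: "0 < m" using r_density_pos[OF H] m by simp
  have "M * 1 \<le> e * T" using M T by (intro mult_mono) auto
  then have D1: "1 \<le> D" using M by (simp add: D_def)
  have p: "0 < p" "p \<le> 1" using D1 m0 by (auto simp: p_def powr_le_one_le ge_one_powr_ge_zero powr_minus inverse_le_1_iff)
  have fE: "finite (edges G)" using G(1) by (rule uniform_finite_edges)
  have y0: "0 < y" using e0 M by (simp add: y_def)
  have r1: "1 \<le> r"
  proof (rule ccontr)
    assume "\<not> 1 \<le> r"
    then have r0: "r = 0" by simp
    have "e = {}" if "e \<in> edges H" for e
    proof -
      have "e \<subseteq> verts H" "finite (verts H)" "card e = 0"
        using H(1) that r0 by (auto simp: uniform_hypergraph_def)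
      then show ?thesis using finite_subset card_0_eq by metis
    qed
    then have "edges H \<subseteq> {{}}" by auto
    then have "card (edges H) \<le> card {{} :: 'a set}" by (intro card_mono) auto
    then show False using H(2) by simp
  qed
  have "edges G \<noteq> {}" using e0 e by auto
  then obtain g where "g \<in> edges G" by auto
  then have rn: "r \<le> n" using G by (auto simp: uniform_hypergraph_def intro: card_mono)
  have n0: "0 < n" using rn r1 by simp
  have "real (ex_num r r H) \<ge> 1" using ex_num_pos[OF H(2,1)] by simp
  \<comment> \<open>The hypothesis at s = r gives n^\<alpha> \<le> M r^\<alpha>. Combined with e(G)
    \<le> n^r it yields e(G) / M \<le> n^(r - \<alpha>) r^\<alpha>: a large ratio forces n to be
    large, so the sample is not too small.\<close>
  then have "1 \<le> M * (real r / n) powr \<alpha>" using ex[of r] r1 rn by simp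
  also have "\<dots> = M * real r powr \<alpha> / n powr \<alpha>" using r1 n0 by (simp add: powr_divide)
  finally have nM: "real n powr \<alpha> \<le> M * real r powr \<alpha>" using n0 by (simp add: field_simps)
  have "e \<le> real (n choose r)" using card_edges_le_choose[OF G(1)] e G(2) by simp
  also have "\<dots> \<le> real (n ^ r)" by (intro of_nat_mono binomial_le_pow rn)
  also have "\<dots> = real n powr (r - \<alpha>) * real n powr \<alpha>"
    using n0 by (simp add: powr_add[symmetric] powr_realpow)
  also have "\<dots> \<le> real n powr (r - \<alpha>) * (M * real r powr \<alpha>)"
    using nM by (intro mult_left_mono) auto
  finally have yn: "y \<le> real n powr (r - \<alpha>) * real r powr \<alpha>"
    using M by (simp add: y_def field_simps)
  have p\<theta>: "p powr (r - \<alpha>) * D powr \<theta> = 1"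
    using D1 by (simp add: p_def \<theta>_def powr_powr powr_add[symmetric])
  have big': "2 powr (r - \<alpha>) * 2 * real r ^ r < y * p powr (r - \<alpha>)"
  proof -
    have "2 powr (r - \<alpha>) * 2 * real r ^ r * D powr \<theta> * p powr (r - \<alpha>) < y * p powr (r - \<alpha>)"
      using big p by (intro mult_strict_right_mono) (auto simp: D_def \<theta>_def y_def)
    also have "2 powr (r - \<alpha>) * 2 * real r ^ r * D powr \<theta> * p powr (r - \<alpha>)
        = 2 powr (r - \<alpha>) * 2 * real r ^ r * (p powr (r - \<alpha>) * D powr \<theta>)"
      by (simp only: mult_ac)
    finally show ?thesis using p\<theta> by simp
  qed
  have pn: "real r \<le> p * n"
  proof (rule ccontr)
    assume "\<not> real r \<le> p * n"
    then have "(p * n) powr (r - \<alpha>) < real r powr (r - \<alpha>)"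
      using p n0 \<alpha> by (intro powr_less_mono2) auto
    moreover have "real r powr (r - \<alpha>) * real r powr \<alpha> = real r ^ r"
      using r1 by (simp add: powr_add[symmetric] powr_realpow)
    moreover have "y * p powr (r - \<alpha>) \<le> (p * n) powr (r - \<alpha>) * real r powr \<alpha>"
      using mult_right_mono[OF yn, of "p powr (r - \<alpha>)"] p n0 by (simp add: powr_mult mult_ac)
    moreover have "real r ^ r \<le> 2 powr (r - \<alpha>) * 2 * real r ^ r"
    proof -
      have "1 \<le> 2 powr (r - \<alpha>)" using \<alpha> by (intro ge_one_powr_ge_zero) auto
      then show ?thesis using r1 by simp
    qed
    moreover have "0 < real r powr \<alpha>" using r1 by simp
    ultimately show False
      using big' mult_strict_right_mono[of "(p * n) powr (r - \<alpha>)" "real r powr (r - \<alpha>)" "real r powr \<alpha>"]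
      by linarith
  qed
  \<comment> \<open>Rounding down loses at most a factor 2 since p n \<ge> r \<ge> 1; this is the
    origin of \<open>2 powr (r - \<alpha>)\<close> in the hypothesis.\<close>
  define s where "s = nat \<lfloor>p * n\<rfloor>"
  have s: "real s = of_int \<lfloor>p * n\<rfloor>" using p n0 by (simp add: s_def)
  have "int r \<le> \<lfloor>p * n\<rfloor>" using pn by (simp add: le_floor_iff)
  then have rs: "r \<le> s" by (simp add: s_def)
  have sp: "real s \<le> p * n" using s by simp
  also have "\<dots> \<le> 1 * real n" using p by (intro mult_right_mono) auto
  finally have sn: "s \<le> n" by simp
  have sp2: "p * n \<le> 2 * real s" using s r1 rs by linarith
  define x where "x = real s / n"
  have x: "x \<le> p" "p / 2 \<le> x" "0 < x" "x \<le> 1"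
    using sp sp2 sn n0 r1 rs by (auto simp: x_def field_simps)
  show ?thesis
  proof (rule balanced_hypergraph_of_copies[OF H(1) _ G rs sn])
    show "1 \<le> card (edges H)" using H(2) by simp
    show "0 < M / T" using M T by simp
    have "M \<le> e * T" using \<open>M * 1 \<le> e * T\<close> by simp
    then show "M / T \<le> card (edges G)" using T e by (simp add: field_simps)
    have bD: "M / T / card (edges G) = 1 / D" by (simp add: D_def e)
    fix F assume F: "F \<subseteq> edges H" "F \<noteq> {}"
    have "finite F" using F(1) uniform_finite_edges[OF H(1)] finite_subset by blast
    then have "1 \<le> card F" using F(2) by (simp add: Suc_le_eq card_gt_0_iff)
    show "(real s / n) ^ (card (\<Union>F) - r) \<le> (M / T / card (edges G)) ^ (card F - 1)"
    proof (cases "card F = 1")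
      case True
      then show ?thesis using x by (simp add: x_def[symmetric] power_le_one)
    next
      case False
      then have F2: "2 \<le> card F" using \<open>1 \<le> card F\<close> by simp
      define d where "d = card (\<Union>F) - r"
      have d: "real d = real (card (\<Union>F)) - r" "0 < d"
        using r_density_ge(1)[OF H(1) F(1) F2] by (auto simp: d_def)
      have "(real (card F) - 1) / real d \<le> m"
        using r_density_ge(2)[OF H(1) F(1) F2] unfolding d(1) m .
      then have "real (card F) - 1 \<le> m * d" using d(2) by (simp add: divide_le_eq)
      then have md: "real (card F - 1) \<le> m * d" using F2 by (simp add: of_nat_diff)
      \<comment> \<open>The exponent m in p is chosen for this step: a set F spanning r + d vertices
        has at most m d + 1 edges.\<close>
      have "x ^ d \<le> p ^ d" using x by (intro power_mono) auto
      also have "\<dots> = D powr (- (m * d))"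
        using p by (simp add: powr_realpow[symmetric] p_def powr_powr)
      also have "\<dots> \<le> D powr (- real (card F - 1))" using md D1 by (intro powr_mono) auto
      also have "\<dots> = (1 / D) ^ (card F - 1)"
        using D1 by (simp add: powr_minus powr_realpow power_inverse divide_inverse)
      finally show ?thesis by (simp only: x_def d_def bD)
    qed
  next
    \<comment> \<open>The 2 compensates for the half of the edges reserved for deletion, and r^r for
      the lower bound on the probability that an edge survives.\<close>
    have "2 * real r ^ r < y * x powr (r - \<alpha>)"
    proof -
      have "(p / 2) powr (r - \<alpha>) \<le> x powr (r - \<alpha>)"
        using x p \<alpha> by (intro powr_mono2) auto
      then have "y * (p powr (r - \<alpha>) / 2 powr (r - \<alpha>)) \<le> y * x powr (r - \<alpha>)"
        using y0 p by (intro mult_left_mono) (auto simp: powr_divide)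
      moreover have "2 * real r ^ r < y * (p powr (r - \<alpha>) / 2 powr (r - \<alpha>))"
        using big' by (simp add: field_simps)
      ultimately show ?thesis by linarith
    qed
    then have "M * x powr \<alpha> * (2 * real r ^ r) < M * x powr \<alpha> * (y * x powr (r - \<alpha>))"
      using M x by (intro mult_strict_left_mono) auto
    also have "\<dots> = x ^ r * e"
    proof -
      have "x powr \<alpha> * x powr (r - \<alpha>) = x ^ r"
        using x by (simp add: powr_add[symmetric] powr_realpow)
      then have "M * x powr \<alpha> * (y * x powr (r - \<alpha>)) = x ^ r * (M * y)" by (simp add: mult_ac)
      then show ?thesis using M by (simp add: y_def)
    qed
    finally have "M * x powr \<alpha> < (x / r) ^ r * (e / 2)"
      using r1 by (simp add: field_simps power_divide)
    also have "(x / r) ^ r \<le> real ((n - r) choose (s - r)) / (n choose s)"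
    proof -
      have "(real s / (r * n)) ^ r * (n choose s) \<le> real ((n - r) choose (s - r))"
        by (rule choose_containing_ge[OF rs sn order_refl])
      moreover have "0 < real (n choose s)" using sn by simp
      ultimately show ?thesis by (simp add: x_def field_simps)
    qed
    finally have "M * x powr \<alpha> < real ((n - r) choose (s - r)) / (n choose s) * (e / 2)"
      using e0 by simp
    moreover have "real (ex_num r s H) \<le> M * x powr \<alpha>" unfolding x_def using rs r1 sn by (intro ex) auto
    ultimately show "ex_num r s H < ((n - r) choose (s - r)) / (n choose s) * (card (edges G) / 2)"
      unfolding e by linarith
  qed
qed

lemma has_balanced_copies_eventually_lt:
  fixes \<alpha> \<gamma> :: real
  assumes H: "uniform_hypergraph r H" "2 \<le> card (edges H)"
    and \<alpha>: "\<alpha> < r" "r - 1 / r_density r H < \<alpha>" and \<gamma>: "1 < \<gamma>"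
  shows "\<exists>t0. \<forall>n (M::real) (G :: nat hypergraph) t.
    (\<forall>s\<in>{1..n}. real (ex_num r s H) \<le> M * (real s / real n) powr \<alpha>) \<longrightarrow> 0 < M \<longrightarrow>
    uniform_hypergraph r G \<longrightarrow> card (verts G) = n \<longrightarrow> t0 \<le> t \<longrightarrow> \<gamma> ^ t * M < card (edges G) \<longrightarrow>
    has_balanced_copies H G (M / (real t + 1) ^ 3)"
proof -
  define m where "m = r_density r H"
  define \<theta> where "\<theta> = m * (r - \<alpha>)"
  define c where "c = 2 powr (r - \<alpha>) * 2 * real r ^ r"
  have m0: "0 < m" using r_density_pos[OF H] by (simp add: m_def)
  \<comment> \<open>The bound \<theta> < 1 is the hypothesis \<alpha> > r - 1 / m rewritten.\<close>
  have \<theta>: "0 < \<theta>" "\<theta> < 1" using m0 \<alpha> by (auto simp: \<theta>_def m_def[symmetric] field_simps)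
  obtain t0 where t0: "\<And>t. t0 \<le> t \<Longrightarrow> c * (real t + 1) ^ 3 < (\<gamma> ^ t) powr (1 - \<theta>)"
    using polynomial_less_power[OF \<gamma> \<theta>(2)] by blast
  show ?thesis
  proof (intro exI[of _ t0] allI impI)
    fix n :: nat and M :: real and G :: "nat hypergraph" and t :: nat
    assume ex: "\<forall>s\<in>{1..n}. real (ex_num r s H) \<le> M * (real s / real n) powr \<alpha>" and M: "0 < M"
      and G: "uniform_hypergraph r G" "card (verts G) = n" and t: "t0 \<le> t"
      and e: "\<gamma> ^ t * M < card (edges G)"
    define T where "T = (real t + 1) ^ 3"
    define y where "y = card (edges G) / M"
    have T1: "1 \<le> T" unfolding T_def by (rule one_le_power) simp
    have y: "\<gamma> ^ t < y" using e M by (simp add: y_def field_simps)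
    have \<gamma>1: "1 \<le> \<gamma> ^ t" using \<gamma> by (intro one_le_power) simp
    \<comment> \<open>Since T \<ge> 1 and \<theta> < 1, the power of T is at most T, a polynomial in
      t; it is absorbed by y^(1 - \<theta>) because y exceeds \<gamma>^t.\<close>
    have "c * (y * T) powr \<theta> = c * T powr \<theta> * y powr \<theta>"
      using T1 y \<gamma>1 by (simp add: powr_mult)
    also have "\<dots> \<le> c * T * y powr \<theta>"
      using T1 \<theta> powr_mono[of \<theta> 1 T] by (intro mult_right_mono mult_left_mono) (auto simp: c_def)
    also have "\<dots> < (\<gamma> ^ t) powr (1 - \<theta>) * y powr \<theta>"
      using t0[OF t] y \<gamma>1 by (intro mult_strict_right_mono) (auto simp: T_def)
    also have "\<dots> \<le> y powr (1 - \<theta>) * y powr \<theta>"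
      using y \<gamma>1 \<theta> by (intro mult_right_mono powr_mono2) auto
    also have "\<dots> = y" using y \<gamma>1 by (simp add: powr_add[symmetric])
    finally have "c * (y * T) powr \<theta> < y" .
    moreover have "M < card (edges G)"
      using mult_right_mono[OF \<gamma>1, of M] e M by linarith
    ultimately show "has_balanced_copies H G (M / (real t + 1) ^ 3)"
      unfolding T_def[symmetric] using ex M T1
      by (intro has_balanced_copies_numeric[OF H \<alpha>(1) m_def G _ M refl])
         (auto simp: c_def y_def \<theta>_def)
  qed
qed

text \<open>With a single edge in \<open>H\<close> there is no positive density to sample at. Then s
  = n works: all exponents |F| - 1 vanish, and \<gamma>^t > 2 gives e(G) / 2 > M \<ge> ex(n,
  H).\<close>

lemma has_balanced_copies_eventually:
  fixes \<alpha> \<gamma> :: real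
  assumes H: "uniform_hypergraph r H" "1 \<le> card (edges H)"
    and \<alpha>: "r - 1 / r_density r H < \<alpha>" and \<gamma>: "1 < \<gamma>"
  shows "\<exists>t0. \<forall>n (M::real) (G :: nat hypergraph) t.
    (\<forall>s\<in>{1..n}. real (ex_num r s H) \<le> M * (real s / real n) powr \<alpha>) \<longrightarrow> 0 < n \<longrightarrow> 0 < M \<longrightarrow>
    uniform_hypergraph r G \<longrightarrow> card (verts G) = n \<longrightarrow> t0 \<le> t \<longrightarrow> \<gamma> ^ t * M < card (edges G) \<longrightarrow>
    has_balanced_copies H G (M / (real t + 1) ^ 3)"
proof (cases "card (edges H) = 1")
  case True
  obtain t0 where t0: "2 < \<gamma> ^ t0" using real_arch_pow[OF \<gamma>] by blast
  show ?thesis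
  proof (intro exI[of _ t0] allI impI)
    fix n :: nat and M :: real and G :: "nat hypergraph" and t :: nat
    assume ex: "\<forall>s\<in>{1..n}. real (ex_num r s H) \<le> M * (real s / real n) powr \<alpha>" and n: "0 < n"
      and M: "0 < M"
      and G: "uniform_hypergraph r G" "card (verts G) = n" and t: "t0 \<le> t"
      and e: "\<gamma> ^ t * M < card (edges G)"
    have "2 < \<gamma> ^ t" using t0 power_increasing[OF t, of \<gamma>] \<gamma> by linarith
    then have eM: "2 * M < card (edges G)" using e M mult_strict_right_mono[of 2 "\<gamma> ^ t" M] by linarith
    have fE: "finite (edges G)" using G(1) by (rule uniform_finite_edges)
    have "edges G \<noteq> {}" using eM M by auto
    then obtain g where "g \<in> edges G" by auto
    then have rn: "r \<le> n" using G by (auto simp: uniform_hypergraph_def intro: card_mono)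
    have exn: "real (ex_num r n H) \<le> M" using ex n by (auto dest: bspec[of _ _ n])
    have T1: "1 \<le> (real t + 1) ^ 3" by (rule one_le_power) simp
    show "has_balanced_copies H G (M / (real t + 1) ^ 3)"
    proof (rule balanced_hypergraph_of_copies[OF H G rn order_refl])
      show "0 < M / (real t + 1) ^ 3" using M by simp
      have "M / (real t + 1) ^ 3 \<le> M" using M T1 by (simp add: divide_le_eq)
      then show "M / (real t + 1) ^ 3 \<le> card (edges G)" using eM M by linarith
      show "(real n / n) ^ (card (\<Union>F) - r) \<le> (M / (real t + 1) ^ 3 / card (edges G)) ^ (card F - 1)"
        if F: "F \<subseteq> edges H" for F
        using card_mono[OF uniform_finite_edges[OF H(1)] F] True n by simp
      show "ex_num r n H < ((n - r) choose (n - r)) / (n choose n) * (card (edges G) / 2)"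
        using exn eM by simp
    qed
  qed
next
  case False
  then have H2: "2 \<le> card (edges H)" using H(2) by simp
  have m0: "0 < r_density r H" using r_density_pos[OF H(1) H2] .
  define d where "d = 1 / r_density r H"
  have d: "0 < d" using m0 by (simp add: d_def)
  \<comment> \<open>Lowering \<open>\<alpha>\<close> only weakens the hypothesis on \<open>ex\<close>, because \<open>s / n \<le> 1\<close>.\<close>
  define \<alpha>' where "\<alpha>' = min \<alpha> (r - d / 2)"
  have \<alpha>': "\<alpha>' < r" "r - 1 / r_density r H < \<alpha>'" "\<alpha>' \<le> \<alpha>"
    using d \<alpha> unfolding d_def[symmetric] by (auto simp: \<alpha>'_def)
  from has_balanced_copies_eventually_lt[OF H(1) H2 \<alpha>'(1,2) \<gamma>] obtain t0 where t0:
    "\<And>n (M::real) (G :: nat hypergraph) t.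
    (\<forall>s\<in>{1..n}. real (ex_num r s H) \<le> M * (real s / real n) powr \<alpha>') \<Longrightarrow> 0 < M \<Longrightarrow>
    uniform_hypergraph r G \<Longrightarrow> card (verts G) = n \<Longrightarrow> t0 \<le> t \<Longrightarrow> \<gamma> ^ t * M < card (edges G) \<Longrightarrow>
    has_balanced_copies H G (M / (real t + 1) ^ 3)" by blast
  have weaken: "\<forall>s\<in>{1..n}. real (ex_num r s H) \<le> M * (real s / real n) powr \<alpha>'"
    if "\<forall>s\<in>{1..n}. real (ex_num r s H) \<le> M * (real s / real n) powr \<alpha>" "0 < M" for n and M :: real
  proof
    fix s assume s: "s \<in> {1..n}"
    then have "(real s / real n) powr \<alpha> \<le> (real s / real n) powr \<alpha>'"
      using \<alpha>' by (intro powr_mono') auto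
    then show "real (ex_num r s H) \<le> M * (real s / real n) powr \<alpha>'"
      using that s by (meson mult_left_mono order_trans less_imp_le)
  qed
  show ?thesis by (intro exI[of _ t0] allI impI t0 weaken)
qed

section \<open>Counting free hypergraphs\<close>

text \<open>Each copy gets weight e(G) / e(HG). This cancels the factor e(HG) / e(G) in the degree
  bounds, so K = 2^(2 k + 3) is independent of G, and the average weight per vertex is exactly
  1.\<close>

lemma balanced_weight_of_copies:
  assumes G: "uniform_hypergraph r G" and e: "edges G \<noteq> {}"
    and bal: "has_balanced_copies H G b" and b: "0 < b"
  obtains w where "balanced (card (edges H)) (edges G) (2 ^ (2 * card (edges H) + 3)) (b / card (edges G)) w"
    "sum w (Pow (edges G)) = card (edges G)" "\<And>A. w A \<noteq> 0 \<Longrightarrow> A \<in> copies H G"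
proof -
  define k where "k = card (edges H)"
  define N where "N = real (card (edges G))"
  obtain HG :: "nat set hypergraph" where HG: "verts HG = edges G" "edges HG \<subseteq> copies H G" "edges HG \<noteq> {}"
    "uniform_hypergraph k HG"
    and deg: "\<And>l. l \<in> {1..k} \<Longrightarrow> real (max_degree l HG)
      \<le> 2 ^ (2 * k + 3) * (b / N) ^ (l - 1) * (real (card (edges HG)) / N)"
    using bal unfolding has_balanced_copies_def k_def N_def by blast
  have fE: "finite (edges G)" using G by (rule uniform_finite_edges)
  have fh: "finite (edges HG)" using HG(4) by (rule uniform_finite_edges)
  have N: "0 < N" using e fE by (simp add: N_def card_gt_0_iff)
  define h where "h = real (card (edges HG))"
  have h: "0 < h" using HG(3) fh by (simp add: h_def card_gt_0_iff)
  have hA: "A \<subseteq> edges G \<and> card A = k" if "A \<in> edges HG" for A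
    using HG(1,4) that by (auto simp: uniform_hypergraph_def)
  define w where "w A = (if A \<in> edges HG then N / h else 0)" for A
  have deg_w: "wt_deg (edges G) w T = N / h * card {A \<in> edges HG. T \<subseteq> A}" for T
  proof -
    have "wt_deg (edges G) w T = (\<Sum>A | A \<in> edges HG \<and> T \<subseteq> A. N / h)"
      unfolding wt_deg_def using fE hA by (intro sum.mono_neutral_cong_right) (auto simp: w_def)
    then show ?thesis by simp
  qed
  have deg_le: "wt_deg (edges G) w T \<le> 2 ^ (2 * k + 3) * (b / N) ^ (card T - 1)" if T: "T \<noteq> {}" for T
  proof (cases "{A \<in> edges HG. T \<subseteq> A} = {}")
    \<comment> \<open>This also covers T with more than k elements or outside
      \<open>edges G\<close>, where the bound on \<open>max_degree\<close> says nothing.\<close>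
    case True
    then have "wt_deg (edges G) w T = 0" unfolding deg_w by (simp only: card.empty)
    then show ?thesis using b N by simp
  next
    case False
    then obtain A where A: "A \<in> edges HG" "T \<subseteq> A" by auto
    then have TE: "T \<subseteq> edges G" "finite A" using hA[OF A(1)] finite_subset[OF _ fE] by auto
    then have "card T \<le> k" using card_mono[OF TE(2) A(2)] hA[OF A(1)] by simp
    moreover have "1 \<le> card T"
      using T finite_subset[OF TE(1) fE] by (simp add: Suc_le_eq card_gt_0_iff)
    ultimately have l: "card T \<in> {1..k}" by simp
    have "card {A \<in> edges HG. T \<subseteq> A} \<le> max_degree (card T) HG"
      unfolding max_degree_def
    proof (rule Max_ge)
      show "finite {card {e \<in> edges HG. T' \<subseteq> e} | T'. T' \<subseteq> verts HG \<and> card T' = card T}"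
        by (rule finite_subset[of _ "(\<lambda>T'. card {e \<in> edges HG. T' \<subseteq> e}) ` Pow (verts HG)"])
           (use fE HG(1) in auto)
      show "card {A \<in> edges HG. T \<subseteq> A} \<in> {card {e \<in> edges HG. T' \<subseteq> e} | T'. T' \<subseteq> verts HG \<and> card T' = card T}"
        using TE HG(1) by auto
    qed
    then have "wt_deg (edges G) w T \<le> N / h * max_degree (card T) HG"
      unfolding deg_w using N h by (intro mult_left_mono) auto
    also have "\<dots> \<le> N / h * (2 ^ (2 * k + 3) * (b / N) ^ (card T - 1) * (h / N))"
      using deg[OF l] N h unfolding h_def[symmetric] by (intro mult_left_mono) auto
    also have "\<dots> = 2 ^ (2 * k + 3) * (b / N) ^ (card T - 1)" using N h by simp
    finally show ?thesis .
  qed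
  show ?thesis
  proof (rule that)
    show "balanced (card (edges H)) (edges G) (2 ^ (2 * card (edges H) + 3)) (b / card (edges G)) w"
      unfolding balanced_def k_def[symmetric] N_def[symmetric]
      using deg_le hA N h by (auto simp: w_def)
    have "sum w (Pow (edges G)) = (\<Sum>A\<in>edges HG. N / h)"
      using fE hA by (intro sum.mono_neutral_cong_right) (auto simp: w_def)
    then show "sum w (Pow (edges G)) = card (edges G)" using h by (simp add: h_def N_def)
    show "A \<in> copies H G" if "w A \<noteq> 0" for A using that HG(2) by (auto simp: w_def split: if_splits)
  qed
qed

text \<open>The vertex set stays fixed while \<open>E\<close> shrinks to containers, so n and the
  hypothesis on ex remain the same throughout the iteration.\<close>

definition free_subsets :: "'a hypergraph \<Rightarrow> 'b set \<Rightarrow> 'b set set \<Rightarrow> 'b set set set" where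
  "free_subsets H V E = {I. I \<subseteq> E \<and> hfree H (Hypergraph V I)}"

lemma finite_free_subsets: "finite E \<Longrightarrow> finite (free_subsets H V E)"
  by (rule finite_subset[of _ "Pow E"]) (auto simp: free_subsets_def)

lemma card_free_subsets_le: "finite E \<Longrightarrow> card (free_subsets H V E) \<le> 2 ^ card E"
  using card_mono[of "Pow E" "free_subsets H V E"] by (auto simp: free_subsets_def card_Pow)

lemma hfree_no_copy:
  assumes "hfree H (Hypergraph V I)" "A \<in> copies H G" "verts G = V"
  shows "\<not> A \<subseteq> I"
proof
  assume "A \<subseteq> I"
  then have "A \<in> copies H (Hypergraph V I)" using assms(2,3) by (auto simp: copies_def)
  then show False using assms(1) by (simp add: hfree_def)
qed

text \<open>Taking c = 1 and K = 2^(2 k + 3) makes \<delta> and B depend on the number of edges of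
  \<open>H\<close> alone; they are fixed before r, G and b. The exponent is the count of sets of
  size at most B q e(G) = B b for q = b / e(G), raised to the power k.\<close>

lemma container_family:
  assumes H: "1 \<le> card (edges H)"
  obtains \<delta> B :: real where "0 < \<delta>" "\<delta> < 1" "0 < B"
    "\<And>r (G :: nat hypergraph) (b :: real). uniform_hypergraph r G \<Longrightarrow> edges G \<noteq> {} \<Longrightarrow> has_balanced_copies H G b \<Longrightarrow>
      0 < b \<Longrightarrow> b \<le> card (edges G) \<Longrightarrow> B * (b / card (edges G)) \<le> \<delta> \<Longrightarrow>
      \<exists>\<C>. finite \<C> \<and>
        real (card \<C>) \<le> exp (card (edges H) * b * (1 + B * ln (card (edges G) / b))) \<and>
        (\<forall>C\<in>\<C>. C \<subseteq> edges G \<and> real (card C) \<le> (1 - \<delta>) * card (edges G)) \<and>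
        (\<forall>I\<in>free_subsets H (verts G) (edges G). \<exists>C\<in>\<C>. I \<subseteq> C)"
proof -
  define k where "k = card (edges H)"
  have k: "1 \<le> k" using H by (simp add: k_def)
  have "(0::real) < 1" "(0::real) < 2 ^ (2 * k + 3)" by simp_all
  from containers[OF k this] obtain \<delta> B :: real where dB: "0 < \<delta>" "\<delta> < 1" "0 < B" and cont:
    "\<And>(V :: nat set set) w (q::real). finite V \<Longrightarrow> 0 < q \<Longrightarrow> B * q \<le> \<delta> \<Longrightarrow>
     balanced k V (2 ^ (2 * k + 3)) q w \<Longrightarrow> 1 * real (card V) \<le> sum w (Pow V) \<Longrightarrow>
     (\<exists>\<C>. finite \<C> \<and> card \<C> \<le> card (small_subsets V (B * q * card V)) ^ k \<and>
        (\<forall>C\<in>\<C>. C \<subseteq> V \<and> real (card C) \<le> (1 - \<delta>) * card V) \<and> covers V w \<C>)"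
    by blast
  show ?thesis
  proof (rule that[OF dB])
    fix r :: nat and b :: real and G :: "nat hypergraph"
    assume G: "uniform_hypergraph r G" "edges G \<noteq> {}" and bal: "has_balanced_copies H G b"
      and b: "0 < b" "b \<le> card (edges G)" and Bb: "B * (b / card (edges G)) \<le> \<delta>"
    define N where "N = real (card (edges G))"
    have fE: "finite (edges G)" using G(1) by (rule uniform_finite_edges)
    have N: "0 < N" using fE G(2) by (simp add: N_def card_gt_0_iff)
    obtain w where w: "balanced k (edges G) (2 ^ (2 * k + 3)) (b / N) w"
      "sum w (Pow (edges G)) = N" "\<And>A. w A \<noteq> 0 \<Longrightarrow> A \<in> copies H G"
      using balanced_weight_of_copies[OF G bal b(1)] unfolding k_def N_def by blast
    have q: "0 < b / N" "b / N \<le> 1" using b N by (auto simp: N_def)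
    obtain \<C> where C: "finite \<C>" "card \<C> \<le> card (small_subsets (edges G) (B * (b / N) * N)) ^ k"
      "\<forall>C\<in>\<C>. C \<subseteq> edges G \<and> real (card C) \<le> (1 - \<delta>) * N" "covers (edges G) w \<C>"
      using cont[OF fE q(1) _ w(1)] w(2) Bb unfolding N_def by auto
    have "real (card \<C>) \<le> real (card (small_subsets (edges G) (B * (b / N) * N))) ^ k"
      using C(2) by (metis of_nat_mono of_nat_power)
    also have "\<dots> \<le> exp (b / N * card (edges G) + B * (b / N) * N * ln (1 / (b / N))) ^ k"
      by (intro power_mono card_small_subsets_le fE q) auto
    also have "\<dots> = exp (k * b * (1 + B * ln (N / b)))"
      using N by (simp add: exp_of_nat_mult[symmetric] N_def[symmetric] algebra_simps)
    finally have card_C: "real (card \<C>) \<le> exp (k * b * (1 + B * ln (N / b)))" .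
    have "\<exists>C\<in>\<C>. I \<subseteq> C" if I: "I \<in> free_subsets H (verts G) (edges G)" for I
    proof -
      have "\<not> A \<subseteq> I" if "w A \<noteq> 0" for A
        using hfree_no_copy[OF _ w(3)[OF that] refl] I by (simp add: free_subsets_def)
      then show ?thesis using C(4) I by (auto simp: covers_def free_subsets_def)
    qed
    then show "\<exists>\<C>. finite \<C> \<and>
        real (card \<C>) \<le> exp (card (edges H) * b * (1 + B * ln (card (edges G) / b))) \<and>
        (\<forall>C\<in>\<C>. C \<subseteq> edges G \<and> real (card C) \<le> (1 - \<delta>) * card (edges G)) \<and>
        (\<forall>I\<in>free_subsets H (verts G) (edges G). \<exists>C\<in>\<C>. I \<subseteq> C)"
      using C card_C unfolding k_def N_def by blast
  qed
qed

section \<open>Iterating the containers\<close>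

lemma card_free_subsets_le_sum:
  fixes x :: real
  assumes "finite \<C>" "\<And>C. C \<in> \<C> \<Longrightarrow> finite C" and cov: "\<And>I. I \<in> free_subsets H V E \<Longrightarrow> \<exists>C\<in>\<C>. I \<subseteq> C"
    and bound: "\<And>C. C \<in> \<C> \<Longrightarrow> real (card (free_subsets H V C)) \<le> x"
  shows "real (card (free_subsets H V E)) \<le> card \<C> * x"
proof -
  have "free_subsets H V E \<subseteq> (\<Union>C\<in>\<C>. free_subsets H V C)"
  proof
    fix I assume I: "I \<in> free_subsets H V E"
    then obtain C where "C \<in> \<C>" "I \<subseteq> C" using cov by blast
    then show "I \<in> (\<Union>C\<in>\<C>. free_subsets H V C)" using I by (auto simp: free_subsets_def)
  qed
  then have "card (free_subsets H V E) \<le> card (\<Union>C\<in>\<C>. free_subsets H V C)"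
    using assms(1,2) by (intro card_mono finite_UN_I finite_free_subsets) auto
  also have "\<dots> \<le> (\<Sum>C\<in>\<C>. card (free_subsets H V C))" by (rule card_UN_le[OF assms(1)])
  finally have "real (card (free_subsets H V E)) \<le> (\<Sum>C\<in>\<C>. real (card (free_subsets H V C)))"
    by (metis of_nat_mono of_nat_sum)
  also have "\<dots> \<le> (\<Sum>C\<in>\<C>. x)" by (intro sum_mono bound)
  finally show ?thesis by simp
qed

text \<open>With u = t + 1 the logarithm is at most u ln \<gamma> + 3 ln u \<le> u (ln \<gamma> +
  3), which uses up one of the three factors u in the denominator. The remaining 1 / u^2 is bounded
  by 1 / t - 1 / u so that the costs telescope.\<close>

lemma container_exponent_le:
  fixes M B \<gamma> N :: real
  assumes t: "1 \<le> t" and M: "0 < M" and N: "0 < N" "N \<le> \<gamma> ^ (t + 1) * M" and \<gamma>: "1 < \<gamma>" and B: "0 < B"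
  shows "M / (real t + 1) ^ 3 * (1 + B * ln (N / (M / (real t + 1) ^ 3)))
    \<le> M * (1 + B * (ln \<gamma> + 3)) * (1 / t - 1 / (real t + 1))"
proof -
  define u where "u = real t + 1"
  have u: "2 \<le> u" using t by (simp add: u_def)
  have "ln (N / (M / u ^ 3)) \<le> ln (\<gamma> ^ (t + 1) * u ^ 3)"
  proof (rule ln_mono)
    show "0 < N / (M / u ^ 3)" using M N u by simp
    have "N * u ^ 3 \<le> \<gamma> ^ (t + 1) * M * u ^ 3" using N u by (intro mult_right_mono) auto
    then show "N / (M / u ^ 3) \<le> \<gamma> ^ (t + 1) * u ^ 3" using M u by (simp add: field_simps)
  qed
  also have "\<dots> = u * ln \<gamma> + 3 * ln u"
    using u \<gamma> by (simp add: ln_mult ln_realpow u_def algebra_simps)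
  also have "\<dots> \<le> u * ln \<gamma> + 3 * u" using ln_le_minus_one[of u] u by simp
  finally have ln_le: "ln (N / (M / u ^ 3)) \<le> u * (ln \<gamma> + 3)" by (simp add: algebra_simps)
  define L where "L = 1 + B * (ln \<gamma> + 3)"
  have L: "0 \<le> L" using B \<gamma> by (simp add: L_def)
  have "B * ln (N / (M / u ^ 3)) \<le> B * (u * (ln \<gamma> + 3))"
    using ln_le B by (intro mult_left_mono) auto
  then have "1 + B * ln (N / (M / u ^ 3)) \<le> u * L"
    using u by (simp add: L_def algebra_simps)
  then have "M / u ^ 3 * (1 + B * ln (N / (M / u ^ 3))) \<le> M / u ^ 3 * (u * L)"
    using M u by (intro mult_left_mono) auto
  also have "\<dots> = M * L * (1 / u ^ 2)" using u by (simp add: power2_eq_square power3_eq_cube)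
  also have "\<dots> \<le> M * L * (1 / t - 1 / u)"
  proof (rule mult_left_mono)
    have "1 / t - 1 / u = 1 / (t * u)" using t by (simp add: u_def field_simps)
    also have "\<dots> \<ge> 1 / u ^ 2"
      using t u by (intro divide_left_mono) (auto simp: u_def power2_eq_square)
    finally show "1 / u ^ 2 \<le> 1 / t - 1 / u" .
    show "0 \<le> M * L" using M L by simp
  qed
  finally show ?thesis by (simp add: u_def L_def)
qed

text \<open>The constants are fixed in the order \<delta>, \<gamma>, \<open>t1\<close>, which is
  possible because \<delta> does not depend on \<gamma>. The exponent A + L (1 - 1 / t) grows by the
  telescoping cost L (1 / t - 1 / (t + 1)) in each step and never exceeds A + L.\<close>

lemma card_free_subsets_bound:
  fixes H :: "'a hypergraph" and \<alpha> :: real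
  assumes H: "uniform_hypergraph r H" "1 \<le> card (edges H)"
    and \<alpha>: "r - 1 / r_density r H < \<alpha>"
  shows "\<exists>C. \<forall>(n::nat) (M::real) V E. (\<forall>s\<in>{1..n}. real (ex_num r s H) \<le> M * (real s / real n) powr \<alpha>) \<longrightarrow>
    0 < n \<longrightarrow> 0 < M \<longrightarrow> uniform_hypergraph r (Hypergraph V E) \<longrightarrow> card (V :: nat set) = n \<longrightarrow>
    real (card (free_subsets H V E)) \<le> exp (C * M)"
proof -
  define k where "k = card (edges H)"
  obtain \<delta> B :: real where dB: "0 < \<delta>" "\<delta> < 1" "0 < B" and cont:
    "\<And>r (G :: nat hypergraph) (b :: real). uniform_hypergraph r G \<Longrightarrow> edges G \<noteq> {} \<Longrightarrow> has_balanced_copies H G b \<Longrightarrow>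
      0 < b \<Longrightarrow> b \<le> card (edges G) \<Longrightarrow> B * (b / card (edges G)) \<le> \<delta> \<Longrightarrow>
      \<exists>\<C>. finite \<C> \<and>
        real (card \<C>) \<le> exp (k * b * (1 + B * ln (card (edges G) / b))) \<and>
        (\<forall>C\<in>\<C>. C \<subseteq> edges G \<and> real (card C) \<le> (1 - \<delta>) * card (edges G)) \<and>
        (\<forall>I\<in>free_subsets H (verts G) (edges G). \<exists>C\<in>\<C>. I \<subseteq> C)"
    using container_family[OF H(2)] unfolding k_def by blast
  define \<gamma> where "\<gamma> = 1 / (1 - \<delta>)"
  have \<gamma>: "1 < \<gamma>" "(1 - \<delta>) * \<gamma> = 1" using dB by (auto simp: \<gamma>_def field_simps)
  obtain t0 where t0: "\<And>n (M::real) (G :: nat hypergraph) t.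
    (\<forall>s\<in>{1..n}. real (ex_num r s H) \<le> M * (real s / real n) powr \<alpha>) \<Longrightarrow> 0 < n \<Longrightarrow> 0 < M \<Longrightarrow>
    uniform_hypergraph r G \<Longrightarrow> card (verts G) = n \<Longrightarrow> t0 \<le> t \<Longrightarrow> \<gamma> ^ t * M < card (edges G) \<Longrightarrow>
    has_balanced_copies H G (M / (real t + 1) ^ 3)"
    using has_balanced_copies_eventually[OF H \<alpha> \<gamma>(1)] by blast
  obtain t2 where t2: "B / \<delta> < \<gamma> ^ t2" using real_arch_pow[OF \<gamma>(1)] by blast
  \<comment> \<open>From t0 on balanced copies exist; from t2 on q = b / N \<le> 1 / \<gamma>^t is
    small enough for B q \<le> \<delta>; t \<ge> 1 keeps 1 / t meaningful.\<close>
  define t1 where "t1 = max 1 (max t0 t2)"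
  define L where "L = k * (1 + B * (ln \<gamma> + 3))"
  have L: "0 \<le> L" using dB \<gamma> by (simp add: L_def)
  \<comment> \<open>At the threshold all subsets of \<open>E\<close> are counted, at most 2 to the
    power \<gamma>^t1 M.\<close>
  define A where "A = \<gamma> ^ t1 * ln 2"
  show ?thesis
  proof (intro exI[of _ "A + L"] allI impI)
    fix n :: nat and M :: real and V :: "nat set" and E
    assume ex: "\<forall>s\<in>{1..n}. real (ex_num r s H) \<le> M * (real s / real n) powr \<alpha>"
      and n: "0 < n" and M: "0 < M" and G: "uniform_hypergraph r (Hypergraph V E)" and V: "card V = n"
    have bound: "real (card (free_subsets H V E)) \<le> exp (M * (A + L * (1 - 1 / t)))"
      if "t1 \<le> t" "uniform_hypergraph r (Hypergraph V E)" "card E \<le> \<gamma> ^ t * M" for t E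
      using that
    proof (induction t arbitrary: E rule: dec_induct)
      case base
      have fE: "finite E" using uniform_finite_edges[OF base(1)] by simp
      have "real (card (free_subsets H V E)) \<le> 2 ^ card E"
        using of_nat_mono[OF card_free_subsets_le[OF fE, of H V], where 'a=real] by simp
      also have "\<dots> = exp (card E * ln 2)" by (simp add: exp_of_nat_mult)
      also have "\<dots> \<le> exp (M * A)" using base(2) by (simp add: A_def mult_ac)
      also have "\<dots> \<le> exp (M * (A + L * (1 - 1 / t1)))"
        using M L by (simp add: t1_def)
      finally show ?case .
    next
      case (step t)
      have t: "1 \<le> t" "t0 \<le> t" "t2 \<le> t" using step.hyps by (auto simp: t1_def)
      show ?case
      proof (cases "card E \<le> \<gamma> ^ t * M")
        case True
        then have "real (card (free_subsets H V E)) \<le> exp (M * (A + L * (1 - 1 / t)))"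
          by (intro step.IH step.prems)
        also have "\<dots> \<le> exp (M * (A + L * (1 - 1 / Suc t)))"
          using M L t by (simp add: mult_left_mono frac_le)
        finally show ?thesis .
      next
        case False
        define b where "b = M / (real t + 1) ^ 3"
        define N where "N = real (card E)"
        have b: "0 < b" using M by (simp add: b_def)
        have fE: "finite E" using uniform_finite_edges[OF step.prems(1)] by simp
        have N: "\<gamma> ^ t * M < N" "N \<le> \<gamma> ^ (t + 1) * M" using False step.prems(2) by (auto simp: N_def)
        have "0 < \<gamma> ^ t * M" using \<gamma> M by simp
        then have N0: "0 < N" using N by linarith
        have "1 \<le> (real t + 1) ^ 3" by (rule one_le_power) simp
        then have bM: "b \<le> M" using M by (simp add: b_def divide_le_eq)
        have \<gamma>t: "1 \<le> \<gamma> ^ t" using \<gamma> by (intro one_le_power) simp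
        have bN: "\<gamma> ^ t * b \<le> N" using mult_left_mono[OF bM, of "\<gamma> ^ t"] \<gamma>t N by linarith
        have "1 * b \<le> \<gamma> ^ t * b" using \<gamma>t b by (intro mult_right_mono) auto
        then have bN1: "b \<le> N" using bN by linarith
        have "\<gamma> ^ t2 \<le> \<gamma> ^ t" using t \<gamma> by (intro power_increasing) auto
        then have "B / \<delta> \<le> \<gamma> ^ t" using t2 by linarith
        then have "B \<le> \<delta> * \<gamma> ^ t" using dB by (simp add: field_simps)
        then have "B * b \<le> \<delta> * \<gamma> ^ t * b" using b by (intro mult_right_mono) auto
        also have "\<dots> \<le> \<delta> * N" using bN dB by (simp add: mult.assoc)
        finally have BN: "B * (b / N) \<le> \<delta>" using N0 by (simp add: field_simps)
        have bal: "has_balanced_copies H (Hypergraph V E) b"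
          unfolding b_def using ex n M step.prems(1) V t N by (intro t0) (auto simp: N_def)
        have "edges (Hypergraph V E) \<noteq> {}" using N0 by (auto simp: N_def)
        from cont[OF step.prems(1) this bal b, unfolded hypergraph.sel, folded N_def, OF bN1 BN]
        obtain \<C> where C: "finite \<C>" "real (card \<C>) \<le> exp (k * b * (1 + B * ln (N / b)))"
          "\<forall>C\<in>\<C>. C \<subseteq> E \<and> real (card C) \<le> (1 - \<delta>) * N"
          "\<forall>I\<in>free_subsets H V E. \<exists>C\<in>\<C>. I \<subseteq> C"
          by (elim exE conjE)
        have "real (card (free_subsets H V C)) \<le> exp (M * (A + L * (1 - 1 / t)))" if CC: "C \<in> \<C>" for C
        proof (rule step.IH)
          have C_le: "C \<subseteq> E" "real (card C) \<le> (1 - \<delta>) * N" using C(3) CC by auto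
          show "uniform_hypergraph r (Hypergraph V C)"
            using C_le(1) step.prems(1) by (auto simp: uniform_hypergraph_def)
          have "real (card C) \<le> (1 - \<delta>) * N" by (rule C_le)
          also have "\<dots> \<le> (1 - \<delta>) * (\<gamma> ^ (t + 1) * M)"
            using N(2) dB by (intro mult_left_mono) auto
          also have "\<dots> = ((1 - \<delta>) * \<gamma>) * (\<gamma> ^ t * M)" by simp
          finally show "real (card C) \<le> \<gamma> ^ t * M" using \<gamma>(2) by simp
        qed
        then have "real (card (free_subsets H V E)) \<le> card \<C> * exp (M * (A + L * (1 - 1 / t)))"
          using C fE by (intro card_free_subsets_le_sum) (auto intro: finite_subset)
        also have "\<dots> \<le> exp (k * b * (1 + B * ln (N / b))) * exp (M * (A + L * (1 - 1 / t)))"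
          using C(2) by (intro mult_right_mono) auto
        also have "\<dots> = exp (k * (b * (1 + B * ln (N / b))) + M * (A + L * (1 - 1 / t)))"
          by (simp add: exp_add mult.assoc)
        also have "\<dots> \<le> exp (M * L * (1 / t - 1 / (real t + 1)) + M * (A + L * (1 - 1 / t)))"
        proof -
          have "b * (1 + B * ln (N / b)) \<le> M * (1 + B * (ln \<gamma> + 3)) * (1 / t - 1 / (real t + 1))"
            unfolding b_def by (rule container_exponent_le[OF t(1) M N0 N(2) \<gamma>(1) dB(3)])
          then have "k * (b * (1 + B * ln (N / b)))
              \<le> k * (M * (1 + B * (ln \<gamma> + 3)) * (1 / t - 1 / (real t + 1)))"
            by (intro mult_left_mono) auto
          also have "\<dots> = M * L * (1 / t - 1 / (real t + 1))" by (simp add: L_def)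
          finally show ?thesis by simp
        qed
        also have "\<dots> = exp (M * (A + L * (1 - 1 / Suc t)))" by (simp add: algebra_simps)
        finally show ?thesis .
      qed
    qed
    obtain t where "card E / M < \<gamma> ^ t" using real_arch_pow[OF \<gamma>(1)] by blast
    also have "\<gamma> ^ t \<le> \<gamma> ^ max t t1" using \<gamma> by (intro power_increasing) auto
    finally have "card E \<le> \<gamma> ^ max t t1 * M" using M by (simp add: field_simps)
    from bound[OF _ G this] have "real (card (free_subsets H V E)) \<le> exp (M * (A + L * (1 - 1 / max t t1)))"
      by simp
    also have "\<dots> \<le> exp ((A + L) * M)"
    proof -
      have "L * (1 - 1 / max t t1) \<le> L * 1" using L by (intro mult_left_mono) auto
      then show ?thesis using M by (simp add: mult.commute)
    qed
    finally show "real (card (free_subsets H V E)) \<le> exp ((A + L) * M)" .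
  qed
qed

lemma card_free_hypergraphs_le:
  "card (free_hypergraphs r n H) \<le> card (free_subsets H {1..n} {e. e \<subseteq> {1..n} \<and> card e = r})"
proof -
  have "free_hypergraphs r n H \<subseteq> Hypergraph {1..n} ` free_subsets H {1..n} {e. e \<subseteq> {1..n} \<and> card e = r}"
  proof
    fix G assume "G \<in> free_hypergraphs r n H"
    then show "G \<in> Hypergraph {1..n} ` free_subsets H {1..n} {e. e \<subseteq> {1..n} \<and> card e = r}"
      by (cases G) (auto simp: free_hypergraphs_def free_subsets_def uniform_hypergraph_def)
  qed
  then show ?thesis by (rule surj_card_le[rotated]) (simp add: finite_free_subsets)
qed

lemma hfree_edgeless:
  assumes "edges H = {}" "verts G = verts G'"
  shows "hfree H G \<longleftrightarrow> hfree H G'"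
  using assms by (simp add: hfree_def copies_def)

theorem theorem4p1:
  fixes H :: "'a hypergraph" and r :: nat and \<alpha> :: real
  assumes "uniform_hypergraph r H"
    and "\<alpha> > real r - 1 / r_density r H"
  shows "(\<forall>\<gamma>::real. \<gamma> > 1 \<longrightarrow> (\<exists>t0::int. \<forall>(n::nat) (M::real).
            n > 0 \<longrightarrow>
            (\<forall>s\<in>{1..n}. real (ex_num r s H) \<le> M * (real s / real n) powr \<alpha>) \<longrightarrow>
            (\<forall>(G :: nat hypergraph) (t::int).
               uniform_hypergraph r G \<longrightarrow> card (verts G) = n \<longrightarrow> t \<ge> t0 \<longrightarrow>
               \<gamma> powi t * M < real (card (edges G)) \<longrightarrow>
               real (card (edges G)) \<le> \<gamma> powi (t + 1) * M \<longrightarrow>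
               (\<exists>HG :: nat set hypergraph.
                  verts HG = edges G \<and> edges HG \<subseteq> copies H G \<and> edges HG \<noteq> {} \<and>
                  uniform_hypergraph (card (edges H)) HG \<and>
                  (let b = M / (real_of_int t + 1) ^ 3 in
                   \<forall>l\<in>{1..card (edges H)}.
                     real (max_degree l HG)
                       \<le> 2 ^ (2 * card (edges H) + 3)
                          * (b / real (card (edges G))) ^ (l - 1)
                          * (real (card (edges HG)) / real (card (edges G))))))))
       \<and> (\<exists>C::real. \<forall>(n::nat) (M::real).
            n > 0 \<longrightarrow>
            (\<forall>s\<in>{1..n}. real (ex_num r s H) \<le> M * (real s / real n) powr \<alpha>) \<longrightarrow>
            real (card (free_hypergraphs r n H)) \<le> 2 powr (C * M))"
proof -
  have ex_M: "real (ex_num r n H) \<le> M"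
    if "\<forall>s\<in>{1..n}. real (ex_num r s H) \<le> M * (real s / real n) powr \<alpha>" "0 < n" for n and M :: real
    using bspec[OF that(1), of n] that(2) by simp
  have E0: "edges H = {}" if "\<not> 1 \<le> card (edges H)"
    using that uniform_finite_edges[OF assms(1)] by (simp add: not_le)
  show ?thesis
  proof (intro conjI allI impI)
    fix \<gamma> :: real assume \<gamma>: "1 < \<gamma>"
    have "\<exists>t0. \<forall>n (M::real) (G :: nat hypergraph) t.
      (\<forall>s\<in>{1..n}. real (ex_num r s H) \<le> M * (real s / real n) powr \<alpha>) \<longrightarrow> 0 < n \<longrightarrow> 0 < M \<longrightarrow>
      uniform_hypergraph r G \<longrightarrow> card (verts G) = n \<longrightarrow> t0 \<le> t \<longrightarrow> \<gamma> ^ t * M < card (edges G) \<longrightarrow>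
      has_balanced_copies H G (M / (real t + 1) ^ 3)"
    proof (cases "1 \<le> card (edges H)")
      case True
      then show ?thesis by (rule has_balanced_copies_eventually[OF assms(1) _ assms(2) \<gamma>])
    next
      \<comment> \<open>If \<open>H\<close> has no edges, a copy only requires room for its vertices
        and is the empty edge set. Since e(G) > M \<ge> ex(n, H), there is such a copy; the range of
        l is empty.\<close>
      case False
      show ?thesis
      proof (intro exI[of _ 0] allI impI)
        fix n :: nat and M :: real and G :: "nat hypergraph" and t :: nat
        assume A: "\<forall>s\<in>{1..n}. real (ex_num r s H) \<le> M * (real s / real n) powr \<alpha>" "0 < n" "0 < M"
          "uniform_hypergraph r G" "card (verts G) = n" "\<gamma> ^ t * M < card (edges G)"
        have "1 \<le> \<gamma> ^ t" using \<gamma> by (intro one_le_power) simp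
        then have "M < card (edges G)" using A(3,6) mult_right_mono[of 1 "\<gamma> ^ t" M] by linarith
        then have "\<not> hfree H G" using card_edges_le_ex_num[OF A(4), of H] ex_M[OF A(1,2)] A(5) by auto
        then have "{} \<in> copies H G" using E0[OF False] by (auto simp: hfree_def copies_def)
        then show "has_balanced_copies H G (M / (real t + 1) ^ 3)"
          unfolding has_balanced_copies_def using E0[OF False] uniform_finite_edges[OF A(4)]
          by (intro exI[of _ "Hypergraph (edges G) {{}}"]) (auto simp: uniform_hypergraph_def)
      qed
    qed
    then obtain t0 where t0: "\<And>n (M::real) (G :: nat hypergraph) t.
      (\<forall>s\<in>{1..n}. real (ex_num r s H) \<le> M * (real s / real n) powr \<alpha>) \<Longrightarrow> 0 < n \<Longrightarrow> 0 < M \<Longrightarrow>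
      uniform_hypergraph r G \<Longrightarrow> card (verts G) = n \<Longrightarrow> t0 \<le> t \<Longrightarrow> \<gamma> ^ t * M < card (edges G) \<Longrightarrow>
      has_balanced_copies H G (M / (real t + 1) ^ 3)" by blast
    show "\<exists>t0::int. \<forall>(n::nat) (M::real).
            n > 0 \<longrightarrow>
            (\<forall>s\<in>{1..n}. real (ex_num r s H) \<le> M * (real s / real n) powr \<alpha>) \<longrightarrow>
            (\<forall>(G :: nat hypergraph) (t::int).
               uniform_hypergraph r G \<longrightarrow> card (verts G) = n \<longrightarrow> t \<ge> t0 \<longrightarrow>
               \<gamma> powi t * M < real (card (edges G)) \<longrightarrow>
               real (card (edges G)) \<le> \<gamma> powi (t + 1) * M \<longrightarrow>
               (\<exists>HG :: nat set hypergraph.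
                  verts HG = edges G \<and> edges HG \<subseteq> copies H G \<and> edges HG \<noteq> {} \<and>
                  uniform_hypergraph (card (edges H)) HG \<and>
                  (let b = M / (real_of_int t + 1) ^ 3 in
                   \<forall>l\<in>{1..card (edges H)}.
                     real (max_degree l HG)
                       \<le> 2 ^ (2 * card (edges H) + 3)
                          * (b / real (card (edges G))) ^ (l - 1)
                          * (real (card (edges HG)) / real (card (edges G))))))"
    proof (intro exI[of _ "int t0"] allI impI)
      fix n :: nat and M :: real and G :: "nat hypergraph" and t :: int
      assume n: "0 < n" and ex: "\<forall>s\<in>{1..n}. real (ex_num r s H) \<le> M * (real s / real n) powr \<alpha>"
        and G: "uniform_hypergraph r G" "card (verts G) = n" and t: "int t0 \<le> t"
        and e: "\<gamma> powi t * M < real (card (edges G))" "real (card (edges G)) \<le> \<gamma> powi (t + 1) * M"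
      obtain u where u: "t = int u" "t0 \<le> u" using t by (metis nat_int_comparison(3) nonneg_int_cases of_nat_0_le_iff order_trans)
      \<comment> \<open>M bounds an extremal number, so it is nonnegative; M = 0 would give 0 < e(G)
        \<le> 0.\<close>
      have "0 \<le> M" using ex_M[OF ex n] by linarith
      moreover have "M \<noteq> 0" using e by auto
      ultimately have "has_balanced_copies H G (M / (real u + 1) ^ 3)"
        using ex n G u e by (intro t0) (auto simp: power_int_of_nat)
      then show "\<exists>HG :: nat set hypergraph.
                  verts HG = edges G \<and> edges HG \<subseteq> copies H G \<and> edges HG \<noteq> {} \<and>
                  uniform_hypergraph (card (edges H)) HG \<and>
                  (let b = M / (real_of_int t + 1) ^ 3 in
                   \<forall>l\<in>{1..card (edges H)}.
                     real (max_degree l HG)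
                       \<le> 2 ^ (2 * card (edges H) + 3)
                          * (b / real (card (edges G))) ^ (l - 1)
                          * (real (card (edges HG)) / real (card (edges G))))"
        unfolding has_balanced_copies_def Let_def u(1) of_int_of_nat_eq .
    qed
  next
    have K: "uniform_hypergraph r (Hypergraph {1..n} {e. e \<subseteq> {1..n} \<and> card e = r})" for n :: nat
      by (simp add: uniform_hypergraph_def)
    show "\<exists>C::real. \<forall>(n::nat) (M::real).
            n > 0 \<longrightarrow>
            (\<forall>s\<in>{1..n}. real (ex_num r s H) \<le> M * (real s / real n) powr \<alpha>) \<longrightarrow>
            real (card (free_hypergraphs r n H)) \<le> 2 powr (C * M)"
    proof (cases "1 \<le> card (edges H)")
      case True
      obtain C where C: "\<And>(n::nat) (M::real) V E. (\<forall>s\<in>{1..n}. real (ex_num r s H) \<le> M * (real s / real n) powr \<alpha>) \<Longrightarrow>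
          0 < n \<Longrightarrow> 0 < M \<Longrightarrow> uniform_hypergraph r (Hypergraph V E) \<Longrightarrow> card (V :: nat set) = n \<Longrightarrow>
          real (card (free_subsets H V E)) \<le> exp (C * M)"
        using card_free_subsets_bound[OF assms(1) True assms(2)] by blast
      show ?thesis
      proof (intro exI[of _ "C / ln 2"] allI impI)
        fix n :: nat and M :: real
        assume n: "0 < n" and ex: "\<forall>s\<in>{1..n}. real (ex_num r s H) \<le> M * (real s / real n) powr \<alpha>"
        show "real (card (free_hypergraphs r n H)) \<le> 2 powr (C / ln 2 * M)"
        proof (cases "M > 0")
          case True
          have "real (card (free_hypergraphs r n H)) \<le> exp (C * M)"
            using C[OF ex n True K] of_nat_mono[OF card_free_hypergraphs_le[of r n H], where 'a=real] by simp
          then show ?thesis by (simp add: powr_def)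
        next
          \<comment> \<open>For M = 0 the extremal number vanishes, only the edgeless hypergraph can
            be free, and the bound reads 1.\<close>
          case False
          then have M: "M = 0" "ex_num r n H = 0" using ex_M[OF ex n] by auto
          have "free_hypergraphs r n H \<subseteq> {Hypergraph {1..n} {}}"
          proof
            fix G assume G: "G \<in> free_hypergraphs r n H"
            then have u: "uniform_hypergraph r G" "verts G = {1..n}" "hfree H G"
              by (auto simp: free_hypergraphs_def)
            have "card (edges G) = 0" using card_edges_le_ex_num[OF u(1,3)] u(2) M by simp
            then have "edges G = {}" using uniform_finite_edges[OF u(1)] by simp
            then show "G \<in> {Hypergraph {1..n} {}}" using u(2) by (cases G) simp
          qed
          then have "card (free_hypergraphs r n H) \<le> card {Hypergraph {1..n} {}}"
            by (intro card_mono) auto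
          then show ?thesis using M by simp
        qed
      qed
    next
      \<comment> \<open>Freeness from an edgeless \<open>H\<close> depends on the vertex set only.
        Hence one free hypergraph makes the complete one free, so M is at least the number of all
        r-sets and counting all subsets is enough.\<close>
      case False
      show ?thesis
      proof (intro exI[of _ 1] allI impI)
        fix n :: nat and M :: real
        assume n: "0 < n" and ex: "\<forall>s\<in>{1..n}. real (ex_num r s H) \<le> M * (real s / real n) powr \<alpha>"
        show "real (card (free_hypergraphs r n H)) \<le> 2 powr (1 * M)"
        proof (cases "free_hypergraphs r n H = {}")
          case False
          define E where "E = {e. e \<subseteq> {1..n} \<and> card e = r}"
          obtain G where "verts G = {1..n}" "hfree H G" using False by (auto simp: free_hypergraphs_def)
          then have "hfree H (Hypergraph {1..n} E)"
            using hfree_edgeless[OF E0, of G "Hypergraph {1..n} E"] \<open>\<not> 1 \<le> card (edges H)\<close> by simp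
          then have "card E \<le> ex_num r n H"
            using card_edges_le_ex_num[OF K[of n, folded E_def]] by simp
          then have cE: "real (card E) \<le> M" using ex_M[OF ex n] by linarith
          have "card (free_hypergraphs r n H) \<le> 2 ^ card E"
            using card_free_hypergraphs_le[of r n H] card_free_subsets_le[of E H "{1..n}"]
            unfolding E_def[symmetric] by (simp add: E_def)
          then have "real (card (free_hypergraphs r n H)) \<le> real (2 ^ card E)" by (rule of_nat_mono)
          also have "\<dots> = 2 powr card E" by (simp add: powr_realpow)
          also have "\<dots> \<le> 2 powr (1 * M)" using cE by simp
          finally show ?thesis .
        qed simp
      qed
    qed
  qed
qed

end
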